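(* Let $P$ be a probability measure on $\mathbb{R}^d$, and let $X_1,\dots,X_n$ be i.i.d. from $P$ with empirical measure $\mathbb{P}_n=\frac1n\sum_{i=1}^n\delta_{X_i}$. Let $\mathcal F$ be a class of functions on $\mathbb{R}^d$ with envelope function $F(x)=B\langle x\rangle^{b+2}$ for some $B>0$, $b\ge0$. Assume $\mathbb{E}_P\|X\|_2^{b+2+c}<\infty$ for some $c>0$, and that there exist some $D_{\mathcal F}>1$ and a function $H:(0,\infty)\to[0,\infty)$ such that for any $x>0$ $$\sup_{P'}\log\mathcal{N}(x,\mathcal F,L^1(P'))\le D_{\mathcal F}\cdot H(x),\qquad\text{and}\qquad\int_0^\infty\sqrt{\frac{H(x)}{x}}\,dx<\infty,$$ where the supremum is over the realizations $P'$ of the empirical measure of $n$ points drawn from the product measure $P^{\otimes n}$. Then $$\mathbb{E}^*\|\mathbb{P}_n-P\|_{\mathcal F}\lesssim D_{\mathcal F}^{\frac{c}{2(b+2+c)}}\cdot n^{-\frac{c^2}{2(b+2+c)^2}},$$ where the suppressed constant depends on $B$, $b$, $c$ and $\mathbb{E}_P\|X\|_2^{b+2+c}$.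
   Context: $\langle x\rangle=1+\|x\|_2$ for $x\in\mathbb{R}^d$; for a measure $\mu$ and function $f$, $\mu f=\int f\,d\mu$. That $F$ is an envelope of $\mathcal F$ means $|f(x)|\le F(x)$ for all $f\in\mathcal F$ and $x\in\mathbb{R}^d$. $\|\mathbb{P}_n-P\|_{\mathcal F}=\sup_{f\in\mathcal F}|(\mathbb{P}_n-P)f|$. $\mathbb{E}^*$ denotes outer expectation. $\mathcal{N}(x,\mathcal F,L^1(P'))$ is the $x$-covering number of $\mathcal F$ in $L^1(P')$. $A\lesssim B$ means $A\le CB$ for a constant $C$ with the stated dependence.
   Formalization: The class F is also assumed to consist of Borel functions and to be P-measurable (weighted suprema over F are measurable for the completed product measures), and the constant may also depend on the value of ∫√(H(x)/x)dx; without these the claim fails. *)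

theory Defs
  imports "HOL-Probability.Probability"
begin

text \<open>The space \<open>\<real>\<^sup>d\<close> is carried by the product measurable space on the index set \<open>{..<d}\<close>
  rather than by a Euclidean type, so that \<open>d\<close> can be quantified after a constant that must
  not depend on it.  Only points of \<^term>\<open>space (Rd d)\<close> (extensional functions) matter.\<close>

definition Rd :: "nat \<Rightarrow> (nat \<Rightarrow> real) measure" where
  "Rd d = Pi\<^sub>M {..<d} (\<lambda>_. borel)"

definition norm2 :: "nat \<Rightarrow> (nat \<Rightarrow> real) \<Rightarrow> real" where
  "norm2 d x = L2_set x {..<d}"

definition bracket :: "nat \<Rightarrow> (nat \<Rightarrow> real) \<Rightarrow> real" where
  "bracket d x = 1 + norm2 d x"

definition is_envelope :: "'a measure \<Rightarrow> ('a \<Rightarrow> real) set \<Rightarrow> ('a \<Rightarrow> real) \<Rightarrow> bool" where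
  "is_envelope M \<F> E \<longleftrightarrow> (\<forall>f\<in>\<F>. \<forall>x\<in>space M. \<bar>f x\<bar> \<le> E x)"

text \<open>An i.i.d. sample of size \<open>n\<close> from \<open>P\<close> is realised by the coordinate projections of the
  product space, as usual when outer expectations are used; a sample is a point \<open>\<xi>\<close> of it.\<close>

definition sample_space :: "nat \<Rightarrow> 'a measure \<Rightarrow> (nat \<Rightarrow> 'a) measure" where
  "sample_space n P = Pi\<^sub>M {..<n} (\<lambda>_. P)"

text \<open>The push-forward of the uniform distribution on the indices, i.e. the average of the
  Dirac measures at \<open>\<xi> 0, \<dots>, \<xi> (n - 1)\<close>.\<close>

definition empirical_measure :: "'a measure \<Rightarrow> nat \<Rightarrow> (nat \<Rightarrow> 'a) \<Rightarrow> 'a measure" where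
  "empirical_measure M n \<xi> = distr (uniform_count_measure {..<n}) M \<xi>"

definition sup_deviation :: "'a measure \<Rightarrow> 'a measure \<Rightarrow> ('a \<Rightarrow> real) set \<Rightarrow> ennreal" where
  "sup_deviation Q P \<F> = (SUP f\<in>\<F>. ennreal \<bar>(\<integral>x. f x \<partial>Q) - (\<integral>x. f x \<partial>P)\<bar>)"

text \<open>Outer expectation of a nonnegative, possibly non-measurable function.  (For such a function
  \<^const>\<open>nn_integral\<close> is a lower integral.)\<close>

definition outer_expectation :: "'a measure \<Rightarrow> ('a \<Rightarrow> ennreal) \<Rightarrow> ennreal" where
  "outer_expectation M Z =
     (INF U\<in>{U \<in> borel_measurable M. \<forall>\<omega>\<in>space M. Z \<omega> \<le> U \<omega>}. \<integral>\<^sup>+\<omega>. U \<omega> \<partial>M)"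

text \<open>Covering numbers with open balls whose centres are arbitrary elements of \<open>L\<^sup>1(Q)\<close>, not
  necessarily in the class; the value is \<open>\<infinity>\<close> if there is no finite cover.\<close>

definition L1_cover :: "real \<Rightarrow> ('a \<Rightarrow> real) set \<Rightarrow> 'a measure \<Rightarrow> ('a \<Rightarrow> real) set \<Rightarrow> bool" where
  "L1_cover \<epsilon> \<F> Q G \<longleftrightarrow> finite G \<and> (\<forall>g\<in>G. integrable Q g) \<and>
     (\<forall>f\<in>\<F>. \<exists>g\<in>G. (\<integral>x. \<bar>f x - g x\<bar> \<partial>Q) < \<epsilon>)"

definition L1_covering_number :: "real \<Rightarrow> ('a \<Rightarrow> real) set \<Rightarrow> 'a measure \<Rightarrow> enat" where
  "L1_covering_number \<epsilon> \<F> Q = (INF G\<in>{G. L1_cover \<epsilon> \<F> Q G}. enat (card G))"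

text \<open>For the empty class the covering number is \<open>0\<close> and its logarithm here is \<open>ln 0 = 0\<close>.\<close>

definition L1_log_covering_number :: "real \<Rightarrow> ('a \<Rightarrow> real) set \<Rightarrow> 'a measure \<Rightarrow> ereal" where
  "L1_log_covering_number \<epsilon> \<F> Q =
     (case L1_covering_number \<epsilon> \<F> Q of enat k \<Rightarrow> ereal (ln (real k)) | \<infinity> \<Rightarrow> \<infinity>)"

text \<open>The \<open>P\<close>-measurable classes of van der Vaart and Wellner: all weighted suprema over the class
  are measurable for the completed product measures.  Without such a condition symmetrization with
  outer expectations breaks down: under the continuum hypothesis, the indicators of the countable
  initial segments of a well-ordering of \<open>\<real>\<close> of type \<open>\<omega>\<^sub>1\<close> have small covering numbers, yet the
  supremum of \<open>\<bar>P\<^sub>n f - P f\<bar>\<close> over them is \<open>1\<close> for every sample from an atomless \<open>P\<close>.\<close>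

definition P_measurable_class :: "'a measure \<Rightarrow> ('a \<Rightarrow> real) set \<Rightarrow> bool" where
  "P_measurable_class P \<F> \<longleftrightarrow>
     (\<forall>m. \<forall>e :: nat \<Rightarrow> real.
        (\<lambda>\<xi>. SUP f\<in>\<F>. ennreal \<bar>\<Sum>i<m. e i * f (\<xi> i)\<bar>)
          \<in> borel_measurable (completion (sample_space m P)))"

end

theory Submission
  imports Defs
begin

text \<open>Write \<open>q = b + 2\<close>, \<open>p = q + c\<close> and \<open>\<theta> = c / p\<close>, so that the rate to be reached is
  \<open>D powr (\<theta> / 2) * n powr (- (\<theta>\<^sup>2 / 2))\<close>.  Cut every function off outside \<open>{\<langle>x\<rangle> \<le> R}\<close>.  The
  functions that remain are bounded by \<open>K = B R\<^sup>q\<close>, and the moment of order \<open>p\<close> controls the integral of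
  the envelope over the complement by a power of \<open>1 / R\<close> (lemma \<open>sup_deviation_truncate\<close>).

  For the bounded class, symmetrization replaces the deviation by a Rademacher average conditional on
  the sample (lemma \<open>symmetrization\<close>).  Boundedness turns the \<open>L\<^sup>1\<close> entropy into \<open>L\<^sup>2\<close> entropy:
  a function bounded by \<open>2 K\<close> of \<open>L\<^sup>1\<close> norm \<open>\<delta>\<close> has squared \<open>L\<^sup>2\<close> norm at most \<open>2 K \<delta>\<close>.  Hence
  each link of a chain through \<open>L\<^sup>1\<close> covers of radii \<open>x j\<close> costs about \<open>sqrt (K D x\<^sub>j H(x\<^sub>j) / n)\<close>, by
  Massart's bound for finite classes (lemmas \<open>massart_finite_class\<close> and \<open>rademacher_chaining\<close>).  In
  every interval \<open>(4\<^sup>-\<^sup>j\<^sup>-\<^sup>1, 4\<^sup>-\<^sup>j]\<close> some point has \<open>x H(x)\<close> no larger than the average suggests, so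
  the sum of \<open>sqrt (x\<^sub>j H(x\<^sub>j))\<close> is at most \<open>2 J + 4\<close> (lemma
  \<open>entropy_scales\<close>).  The bounded class therefore deviates by at most a constant times
  \<open>sqrt (K D / n)\<close> (lemmas \<open>rademacher_entropy_bound\<close> and \<open>bounded_class_deviation\<close>).

  With \<open>R = (n / D) powr (1 / p)\<close> both contributions are at most a constant times
  \<open>(D / n) powr (\<theta> / 2)\<close>.  This is at least as good as the stated rate, because \<open>n \<ge> 1\<close> and
  \<open>\<theta>\<^sup>2 \<le> \<theta>\<close>.

  The outer expectation is bounded by exhibiting one measurable majorant of the deviation.
  Exchanging the average over the signs with the integral over the sample is the one step for which
  lower and upper integrals must agree; there the measurability of the class is used.\<close>

section \<open>Rademacher averages of finite classes\<close>

definition signs :: "nat \<Rightarrow> (nat \<Rightarrow> real) set" where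
  "signs n = {..<n} \<rightarrow>\<^sub>E {-1, 1}"

lemma finite_signs [simp]: "finite (signs n)"
  by (simp add: signs_def finite_PiE)

lemma card_signs: "card (signs n) = 2 ^ n"
  by (simp add: signs_def card_PiE numeral_2_eq_2)

text \<open>Hoeffding's lemma for the uniform distribution on two opposite points.\<close>

lemma cosh_le_exp_half_square: "cosh x \<le> exp (x\<^sup>2 / 2)" for x :: real
proof -
  have *: "cosh y \<le> exp (y\<^sup>2 / 2)" if "y \<ge> 0" for y :: real
  proof -
    have eq: "1 / 2 + exp (2 * y) / 2 = exp y * cosh y"
      by (simp add: cosh_def field_simps flip: exp_add)
    have "- (2 * y) * (1 / 2) + ln (1 + (1 / 2) * (exp (2 * y) - 1)) \<le> (2 * y)\<^sup>2 / 8"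
      using Hoeffdings_lemma_aux[of "2 * y" "1 / 2"] that by (simp add: algebra_simps)
    also have "1 + (1 / 2) * (exp (2 * y) - 1) = exp y * cosh y"
      using eq by (simp add: algebra_simps)
    finally have "ln (cosh y) \<le> y\<^sup>2 / 2"
      by (simp add: ln_mult power2_eq_square)
    thus ?thesis
      by (metis cosh_real_pos exp_le_cancel_iff exp_ln)
  qed
  show ?thesis
    using *[of "\<bar>x\<bar>"] by simp
qed

text \<open>Summing over all sign vectors factorises the exponential into hyperbolic cosines; this is the
  subgaussian bound for the Rademacher sum with coefficients \<open>v\<close>.\<close>

lemma sum_exp_signs_le:
  "(\<Sum>e\<in>signs n. exp (\<Sum>i<n. e i * v i)) \<le> 2 ^ n * exp ((\<Sum>i<n. (v i)\<^sup>2) / 2)"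
proof -
  have "(\<Sum>e\<in>signs n. exp (\<Sum>i<n. e i * v i)) = (\<Sum>e\<in>signs n. \<Prod>i<n. exp (e i * v i))"
    by (simp add: exp_sum)
  also have "\<dots> = (\<Prod>i<n. \<Sum>s\<in>{-1, 1}. exp (s * v i))"
    unfolding signs_def by (rule prod_sum_PiE[symmetric]) auto
  also have "\<dots> = (\<Prod>i<n. 2 * cosh (v i))"
    by (intro prod.cong) (auto simp: cosh_def)
  also have "\<dots> \<le> (\<Prod>i<n. 2 * exp ((v i)\<^sup>2 / 2))"
    by (intro prod_mono) (auto simp: cosh_le_exp_half_square less_imp_le)
  also have "\<dots> = 2 ^ n * exp ((\<Sum>i<n. (v i)\<^sup>2) / 2)"
    by (simp add: prod.distrib exp_sum sum_divide_distrib)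
  finally show ?thesis .
qed

text \<open>The exponential of a maximum is at most the sum of the exponentials, so the subgaussian bound loses
  only a factor \<open>2 * card V\<close>, which the logarithm makes harmless; the \<open>2\<close> pays for the absolute value.\<close>

lemma massart_finite_class:
  assumes "finite V" "V \<noteq> {}" and s: "s > 0"
    and norm: "\<And>v. v \<in> V \<Longrightarrow> (\<Sum>i<n. (v i)\<^sup>2) \<le> s\<^sup>2"
  shows "(\<Sum>e\<in>signs n. MAX v\<in>V. \<bar>\<Sum>i<n. e i * v i\<bar>)
           \<le> 2 ^ n * (s * sqrt (2 * ln (2 * real (card V))))"
proof -
  define N where "N = 2 * real (card V)"
  have "card V \<ge> 1"
    using assms(1,2) by (simp add: Suc_leI card_gt_0_iff)
  hence N: "N \<ge> 2" by (simp add: N_def)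
  \<comment> \<open>This parameter balances \<open>ln N / \<tau>\<close> against \<open>\<tau> s\<^sup>2 / 2\<close>.\<close>
  define \<tau> where "\<tau> = sqrt (2 * ln N) / s"
  have \<tau>: "\<tau> > 0" using N s by (simp add: \<tau>_def)
  have \<tau>s: "(\<tau> * s)\<^sup>2 = 2 * ln N" using N s by (simp add: \<tau>_def)
  define a where "a = ln N + (\<tau> * s)\<^sup>2 / 2"
  define X where "X e = (MAX v\<in>V. \<bar>\<Sum>i<n. e i * v i\<bar>)" for e :: "nat \<Rightarrow> real"
  have exp_X: "exp (\<tau> * X e) \<le> (\<Sum>v\<in>V. exp (\<Sum>i<n. e i * (\<tau> * v i)) + exp (\<Sum>i<n. e i * ((- \<tau>) * v i)))" for e
  proof -
    have "X e \<in> (\<lambda>v. \<bar>\<Sum>i<n. e i * v i\<bar>) ` V"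
      unfolding X_def by (rule Max_in) (use assms in auto)
    then obtain v where v: "v \<in> V" "X e = \<bar>\<Sum>i<n. e i * v i\<bar>" by auto
    have eq: "(\<Sum>i<n. e i * (\<tau> * v i)) = \<tau> * (\<Sum>i<n. e i * v i)"
         "(\<Sum>i<n. e i * ((- \<tau>) * v i)) = - (\<tau> * (\<Sum>i<n. e i * v i))"
      by (simp_all add: sum_distrib_left sum_negf mult.left_commute)
    have "exp (\<tau> * X e) \<le> exp (\<Sum>i<n. e i * (\<tau> * v i)) + exp (\<Sum>i<n. e i * ((- \<tau>) * v i))"
      unfolding eq v(2) using \<tau>
      by (cases "(\<Sum>i<n. e i * v i) \<ge> 0") (auto simp: abs_if intro: less_imp_le)
    also have "\<dots> \<le> (\<Sum>v\<in>V. exp (\<Sum>i<n. e i * (\<tau> * v i)) + exp (\<Sum>i<n. e i * ((- \<tau>) * v i)))"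
      by (rule member_le_sum[OF v(1)]) (auto simp: assms add_nonneg_nonneg)
    finally show ?thesis .
  qed
  have "(\<Sum>e\<in>signs n. exp (\<tau> * X e))
      \<le> (\<Sum>e\<in>signs n. \<Sum>v\<in>V. exp (\<Sum>i<n. e i * (\<tau> * v i)) + exp (\<Sum>i<n. e i * ((- \<tau>) * v i)))"
    by (intro sum_mono exp_X)
  also have "\<dots> = (\<Sum>v\<in>V. (\<Sum>e\<in>signs n. exp (\<Sum>i<n. e i * (\<tau> * v i)))
                         + (\<Sum>e\<in>signs n. exp (\<Sum>i<n. e i * ((- \<tau>) * v i))))"
    by (subst sum.swap) (simp add: sum.distrib)
  also have "\<dots> \<le> (\<Sum>v\<in>V. 2 ^ n * exp ((\<tau> * s)\<^sup>2 / 2) + 2 ^ n * exp ((\<tau> * s)\<^sup>2 / 2))"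
  proof (intro sum_mono add_mono order.trans[OF sum_exp_signs_le] mult_left_mono)
    fix v assume v: "v \<in> V"
    have "(\<Sum>i<n. (\<tau> * v i)\<^sup>2) = \<tau>\<^sup>2 * (\<Sum>i<n. (v i)\<^sup>2)"
      by (simp add: sum_distrib_left power_mult_distrib)
    also have "\<dots> \<le> (\<tau> * s)\<^sup>2"
      using norm[OF v] by (simp add: power_mult_distrib mult_left_mono)
    finally have *: "(\<Sum>i<n. (\<tau> * v i)\<^sup>2) \<le> (\<tau> * s)\<^sup>2" .
    thus "exp ((\<Sum>i<n. (\<tau> * v i)\<^sup>2) / 2) \<le> exp ((\<tau> * s)\<^sup>2 / 2)" by simp
    from * show "exp ((\<Sum>i<n. ((- \<tau>) * v i)\<^sup>2) / 2) \<le> exp ((\<tau> * s)\<^sup>2 / 2)" by simp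
  qed auto
  also have "\<dots> = 2 ^ n * exp a"
    using N by (simp add: a_def N_def exp_add)
  finally have mgf: "(\<Sum>e\<in>signs n. exp (\<tau> * X e)) \<le> 2 ^ n * exp a" .
  \<comment> \<open>The tangent line of the exponential at \<open>a\<close> replaces Jensen's inequality.\<close>
  have "(\<Sum>e\<in>signs n. \<tau> * X e) \<le> (\<Sum>e\<in>signs n. a - 1 + exp (\<tau> * X e) / exp a)"
  proof (intro sum_mono)
    fix e
    show "\<tau> * X e \<le> a - 1 + exp (\<tau> * X e) / exp a"
      using exp_ge_add_one_self[of "\<tau> * X e - a"] by (simp add: exp_diff)
  qed
  also have "\<dots> = 2 ^ n * (a - 1) + (\<Sum>e\<in>signs n. exp (\<tau> * X e)) / exp a"
    by (simp add: sum.distrib card_signs sum_divide_distrib)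
  also have "\<dots> \<le> 2 ^ n * (a - 1) + 2 ^ n"
    using mgf by (simp add: divide_le_eq)
  also have "\<dots> = 2 ^ n * a" by (simp add: algebra_simps)
  finally have "\<tau> * (\<Sum>e\<in>signs n. X e) \<le> 2 ^ n * a"
    by (simp add: sum_distrib_left)
  also have "a = \<tau> * (s * sqrt (2 * ln N))"
    using N s \<tau>s by (simp add: a_def \<tau>_def)
  also have "2 ^ n * (\<tau> * (s * sqrt (2 * ln N))) = \<tau> * (2 ^ n * (s * sqrt (2 * ln N)))"
    by simp
  finally show ?thesis
    using \<tau> unfolding X_def N_def by simp
qed

section \<open>Chaining along covers in mean absolute distance\<close>

text \<open>The class is resolved as a telescoping sum of the links \<open>\<pi> (Suc j) f - \<pi> j f\<close>.  At each level there
  are at most \<open>exp (E j + E (Suc j))\<close> different links, and Massart's bound applies with the squared norm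
  \<open>2 * K * n * \<delta> j\<close>, which comes from \<open>w\<^sup>2 \<le> 2 * K * \<bar>w\<bar>\<close>.  What the last level misses is bounded without
  any cancellation by \<open>\<epsilon>\<close>.\<close>

lemma rademacher_chaining:
  fixes v :: "'f \<Rightarrow> nat \<Rightarrow> real" and \<pi> :: "nat \<Rightarrow> 'f \<Rightarrow> nat \<Rightarrow> real"
  assumes ne: "F \<noteq> {}" and n: "n > 0" and K: "K > 0"
    and bounded: "\<And>j f i. j \<le> L \<Longrightarrow> f \<in> F \<Longrightarrow> i < n \<Longrightarrow> \<bar>\<pi> j f i\<bar> \<le> K"
    and root: "\<And>f i. f \<in> F \<Longrightarrow> \<pi> 0 f i = 0"
    and fin: "\<And>j. j \<le> L \<Longrightarrow> finite (\<pi> j ` F)"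
    and card: "\<And>j. j \<le> L \<Longrightarrow> ln (real (card (\<pi> j ` F))) \<le> E j"
    and \<delta>: "\<And>j. j < L \<Longrightarrow> \<delta> j > 0"
    and link: "\<And>j f. j < L \<Longrightarrow> f \<in> F \<Longrightarrow> (\<Sum>i<n. \<bar>\<pi> (Suc j) f i - \<pi> j f i\<bar>) \<le> n * \<delta> j"
    and leaf: "\<And>f. f \<in> F \<Longrightarrow> (\<Sum>i<n. \<bar>v f i - \<pi> L f i\<bar>) \<le> n * \<epsilon>"
  obtains X where "\<And>e f. e \<in> signs n \<Longrightarrow> f \<in> F \<Longrightarrow> \<bar>\<Sum>i<n. e i * v f i\<bar> \<le> X e"
    and "(\<Sum>e\<in>signs n. X e)
       \<le> 2 ^ n * (n * (2 * sqrt (K / n) * (\<Sum>j<L. sqrt (\<delta> j * (ln 2 + E j + E (Suc j)))) + \<epsilon>))"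
proof -
  define V where "V j = (\<lambda>f i. \<pi> (Suc j) f i - \<pi> j f i) ` F" for j
  define Y where "Y j e = (MAX w\<in>V j. \<bar>\<Sum>i<n. e i * w i\<bar>)" for j and e :: "nat \<Rightarrow> real"
  define X where "X e = (\<Sum>j<L. Y j e) + n * \<epsilon>" for e
  have V_sub: "V j \<subseteq> (\<lambda>(p, q) i. p i - q i) ` (\<pi> (Suc j) ` F \<times> \<pi> j ` F)" for j
    by (auto simp: V_def)
  have finV: "finite (V j)" if "j < L" for j
    using that by (intro finite_subset[OF V_sub] finite_imageI finite_cartesian_product fin) auto
  have V_ne: "V j \<noteq> {}" for j using ne by (simp add: V_def)
  have Y: "(\<Sum>e\<in>signs n. Y j e) \<le> 2 ^ n * (n * (2 * sqrt (K / n) * sqrt (\<delta> j * (ln 2 + E j + E (Suc j)))))"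
    if j: "j < L" for j
  proof -
    define s where "s = sqrt (2 * K * n * \<delta> j)"
    have s: "s > 0" using n K \<delta>[OF j] by (simp add: s_def)
    have s2: "s\<^sup>2 = 2 * K * n * \<delta> j" using n K \<delta>[OF j] by (simp add: s_def)
    have norm: "(\<Sum>i<n. (w i)\<^sup>2) \<le> s\<^sup>2" if "w \<in> V j" for w
    proof -
      obtain f where f: "f \<in> F" "w = (\<lambda>i. \<pi> (Suc j) f i - \<pi> j f i)"
        using \<open>w \<in> V j\<close> by (auto simp: V_def)
      have "(\<Sum>i<n. (w i)\<^sup>2) \<le> (\<Sum>i<n. 2 * K * \<bar>w i\<bar>)"
      proof (intro sum_mono)
        fix i assume i: "i \<in> {..<n}"
        have "\<bar>w i\<bar> \<le> 2 * K"
          using bounded[of "Suc j" f i] bounded[of j f i] f i j by (simp add: f(2))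
        hence "\<bar>w i\<bar> * \<bar>w i\<bar> \<le> 2 * K * \<bar>w i\<bar>" by (intro mult_right_mono) auto
        thus "(w i)\<^sup>2 \<le> 2 * K * \<bar>w i\<bar>" by (simp add: power2_eq_square)
      qed
      also have "\<dots> = 2 * K * (\<Sum>i<n. \<bar>w i\<bar>)" by (simp add: sum_distrib_left)
      also have "\<dots> \<le> 2 * K * (n * \<delta> j)"
        using link[OF j f(1)] K by (intro mult_left_mono) (auto simp: f(2))
      finally show ?thesis by (simp add: s2)
    qed
    have cardV: "real (card (V j)) \<ge> 1"
      using finV[OF j] V_ne[of j] by (simp add: Suc_leI card_gt_0_iff)
    have c1: "real (card (\<pi> k ` F)) \<ge> 1" if "k \<le> L" for k
      using fin[OF that] ne by (simp add: Suc_leI card_gt_0_iff)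
    have "card (V j) \<le> card (\<pi> (Suc j) ` F \<times> \<pi> j ` F)"
      using j by (intro surj_card_le[OF _ V_sub] finite_cartesian_product fin) auto
    hence "real (card (V j)) \<le> real (card (\<pi> (Suc j) ` F)) * real (card (\<pi> j ` F))"
      by (simp add: card_cartesian_product flip: of_nat_mult)
    hence "ln (real (card (V j))) \<le> ln (real (card (\<pi> (Suc j) ` F)) * real (card (\<pi> j ` F)))"
      using cardV by simp
    also have "\<dots> = ln (real (card (\<pi> (Suc j) ` F))) + ln (real (card (\<pi> j ` F)))"
      using c1[of "Suc j"] c1[of j] j by (subst ln_mult) auto
    also have "\<dots> \<le> E (Suc j) + E j"
      using card[of "Suc j"] card[of j] j by simp
    finally have ln_card: "ln (2 * real (card (V j))) \<le> ln 2 + E j + E (Suc j)"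
      using cardV by (simp add: ln_mult)
    have "(\<Sum>e\<in>signs n. Y j e) \<le> 2 ^ n * (s * sqrt (2 * ln (2 * real (card (V j)))))"
      unfolding Y_def by (rule massart_finite_class[OF finV[OF j] V_ne s norm])
    also have "\<dots> \<le> 2 ^ n * (s * sqrt (2 * (ln 2 + E j + E (Suc j))))"
      using ln_card s by (intro mult_left_mono) auto
    also have "s * sqrt (2 * (ln 2 + E j + E (Suc j)))
        = sqrt (n\<^sup>2 * (4 * (K / n) * (\<delta> j * (ln 2 + E j + E (Suc j)))))"
      using n by (simp add: s_def power2_eq_square algebra_simps flip: real_sqrt_mult)
    also have "\<dots> = n * (2 * sqrt (K / n) * sqrt (\<delta> j * (ln 2 + E j + E (Suc j))))"
      by (simp only: real_sqrt_mult real_sqrt_four) simp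
    finally show ?thesis by simp
  qed
  show ?thesis
  proof (rule that[of X])
    fix e f assume e: "e \<in> signs n" and f: "f \<in> F"
    have e1: "\<bar>e i\<bar> = 1" if "i < n" for i
    proof -
      have "e i \<in> {-1, 1}"
        by (rule PiE_mem[OF e[unfolded signs_def]]) (simp add: that)
      thus ?thesis by auto
    qed
    have tele: "(\<Sum>j<L. \<pi> (Suc j) f i - \<pi> j f i) = \<pi> L f i" for i
      using sum_lessThan_telescope[of "\<lambda>j. \<pi> j f i" L] by (simp add: root f)
    have "(\<Sum>i<n. e i * v f i) = (\<Sum>i<n. e i * \<pi> L f i) + (\<Sum>i<n. e i * (v f i - \<pi> L f i))"
      unfolding sum.distrib[symmetric] by (intro sum.cong) (simp_all add: algebra_simps)
    also have "(\<Sum>i<n. e i * \<pi> L f i) = (\<Sum>j<L. \<Sum>i<n. e i * (\<pi> (Suc j) f i - \<pi> j f i))"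
      by (subst sum.swap) (simp only: tele sum_distrib_left[symmetric])
    finally have "\<bar>\<Sum>i<n. e i * v f i\<bar> \<le> \<bar>\<Sum>j<L. \<Sum>i<n. e i * (\<pi> (Suc j) f i - \<pi> j f i)\<bar>
         + \<bar>\<Sum>i<n. e i * (v f i - \<pi> L f i)\<bar>" by simp
    also have "\<dots> \<le> (\<Sum>j<L. Y j e) + n * \<epsilon>"
    proof (rule add_mono)
      have "\<bar>\<Sum>i<n. e i * (\<pi> (Suc j) f i - \<pi> j f i)\<bar> \<le> Y j e" if "j < L" for j
        unfolding Y_def using f finV[OF that] by (intro Max_ge) (auto simp: V_def)
      thus "\<bar>\<Sum>j<L. \<Sum>i<n. e i * (\<pi> (Suc j) f i - \<pi> j f i)\<bar> \<le> (\<Sum>j<L. Y j e)"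
        by (intro order.trans[OF sum_abs sum_mono]) auto
      have "\<bar>\<Sum>i<n. e i * (v f i - \<pi> L f i)\<bar> \<le> (\<Sum>i<n. \<bar>e i * (v f i - \<pi> L f i)\<bar>)"
        by (rule sum_abs)
      also have "\<dots> = (\<Sum>i<n. \<bar>v f i - \<pi> L f i\<bar>)"
        by (intro sum.cong) (auto simp: abs_mult e1)
      finally show "\<bar>\<Sum>i<n. e i * (v f i - \<pi> L f i)\<bar> \<le> n * \<epsilon>" using leaf[OF f] by simp
    qed
    finally show "\<bar>\<Sum>i<n. e i * v f i\<bar> \<le> X e" by (simp add: X_def)
  next
    have "(\<Sum>e\<in>signs n. X e) = (\<Sum>j<L. \<Sum>e\<in>signs n. Y j e) + 2 ^ n * (n * \<epsilon>)"
      unfolding X_def sum.distrib by (subst sum.swap) (simp add: card_signs)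
    also have "\<dots> \<le> (\<Sum>j<L. 2 ^ n * (n * (2 * sqrt (K / n) * sqrt (\<delta> j * (ln 2 + E j + E (Suc j))))))
        + 2 ^ n * (n * \<epsilon>)"
      by (intro add_right_mono sum_mono Y) auto
    also have "\<dots> = 2 ^ n * (n * (2 * sqrt (K / n) * (\<Sum>j<L. sqrt (\<delta> j * (ln 2 + E j + E (Suc j)))) + \<epsilon>))"
      by (simp add: algebra_simps sum_distrib_left)
    finally show "(\<Sum>e\<in>signs n. X e)
       \<le> 2 ^ n * (n * (2 * sqrt (K / n) * (\<Sum>j<L. sqrt (\<delta> j * (ln 2 + E j + E (Suc j)))) + \<epsilon>))" .
  qed
qed

text \<open>For \<open>S\<close> a bound on the sum of \<open>sqrt (x\<^sub>j h\<^sub>j)\<close> over the scales, the factor in front of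
  \<open>sqrt (K D / n)\<close> that the chaining sum produces.\<close>

definition chaining_constant :: "real \<Rightarrow> real" where
  "chaining_constant S = 2 * (5 + 9 * S)"

text \<open>The first link leads from zero to the coarsest cover, so its length involves the mean \<open>A\<close> of the
  envelope instead of a previous radius.\<close>

lemma link_cost_first:
  fixes A D h x :: real
  assumes "D \<ge> 1" "A \<ge> 0" "h \<ge> 0" "1 / 4 \<le> x" "x \<le> 1"
  shows "sqrt ((A + x) * (ln 2 + D * h)) \<le> sqrt D * ((1 + A) * (1 + 2 * sqrt (x * h)))"
proof -
  have ln2: "ln 2 \<le> (1::real)" using ln_2_less_1 by simp
  have "(A + x) * (ln 2 + D * h) \<le> (1 + A) * (D * (1 + h))"
    using assms ln2 by (intro mult_mono) (auto simp: algebra_simps)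
  hence "sqrt ((A + x) * (ln 2 + D * h)) \<le> sqrt ((1 + A) * (D * (1 + h)))" by simp
  also have "\<dots> = sqrt D * (sqrt (1 + A) * sqrt (1 + h))"
    by (simp add: real_sqrt_mult)
  also have "\<dots> \<le> sqrt D * ((1 + A) * (1 + 2 * sqrt (x * h)))"
  proof (intro mult_left_mono mult_mono)
    show "sqrt (1 + A) \<le> 1 + A"
      by (rule real_le_lsqrt) (use assms in \<open>auto simp: power2_eq_square algebra_simps\<close>)
    have "sqrt h \<le> sqrt (4 * (x * h))"
      using mult_right_mono[of 1 "4 * x" h] assms by simp
    also have "\<dots> = 2 * sqrt (x * h)" by (simp only: real_sqrt_mult real_sqrt_four)
    finally have "sqrt h \<le> 2 * sqrt (x * h)" .
    moreover have "sqrt (1 + h) \<le> 1 + sqrt h"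
      using sqrt_add_le_add_sqrt[of 1 h] assms by simp
    ultimately show "sqrt (1 + h) \<le> 1 + 2 * sqrt (x * h)" by simp
  qed (use assms in auto)
  finally show ?thesis .
qed

text \<open>Consecutive radii differ by a factor of at most \<open>16\<close>, so that the mixed products \<open>x * h'\<close> and \<open>x' * h\<close>
  are controlled by the unmixed ones.  The term with \<open>r\<close> pays for the constant \<open>ln 2\<close> in the entropy of a
  link; it is summable because the radii decrease geometrically.\<close>

lemma link_cost_next:
  fixes D h h' x x' r :: real
  assumes "D \<ge> 1" "h \<ge> 0" "h' \<ge> 0" "0 < x'" "x' \<le> x" "x \<le> 16 * x'" "x \<le> r\<^sup>2" "r \<ge> 0"
  shows "sqrt ((x' + x) * (ln 2 + D * h + D * h'))
           \<le> sqrt D * (2 * r + 2 * sqrt (x * h) + 5 * sqrt (x' * h'))"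
proof -
  have ln2: "ln 2 \<le> (1::real)" using ln_2_less_1 by simp
  have "(x' + x) * (ln 2 + D * h + D * h') = (x' + x) * ln 2 + D * ((x' + x) * h) + D * ((x' + x) * h')"
    by (simp add: algebra_simps)
  also have "(x' + x) * ln 2 \<le> (x' + x) * D"
    using assms ln2 by (intro mult_left_mono) auto
  also have "(x' + x) * D \<le> D * (4 * r\<^sup>2)"
    using assms mult_right_mono[of "x' + x" "4 * r\<^sup>2" D] by (simp add: mult.commute)
  also have "D * ((x' + x) * h) \<le> D * (4 * (x * h))"
    using assms mult_right_mono[of "x' + x" "4 * x" h] by (intro mult_left_mono) auto
  also have "D * ((x' + x) * h') \<le> D * (25 * (x' * h'))"
    using assms mult_right_mono[of "x' + x" "25 * x'" h'] by (intro mult_left_mono) auto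
  finally have "sqrt ((x' + x) * (ln 2 + D * h + D * h'))
     \<le> sqrt (D * (4 * r\<^sup>2) + D * (4 * (x * h)) + D * (25 * (x' * h')))" by simp
  also have "\<dots> \<le> sqrt (D * (4 * r\<^sup>2) + D * (4 * (x * h))) + sqrt (D * (25 * (x' * h')))"
    using assms by (intro sqrt_add_le_add_sqrt) auto
  also have "sqrt (D * (4 * r\<^sup>2) + D * (4 * (x * h))) \<le> sqrt (D * (4 * r\<^sup>2)) + sqrt (D * (4 * (x * h)))"
    using assms by (intro sqrt_add_le_add_sqrt) auto
  also have "sqrt (25 * t) = 5 * sqrt t" for t :: real
    using real_sqrt_mult[of "5\<^sup>2" t] by (simp only: real_sqrt_abs) simp
  hence "sqrt (D * (4 * r\<^sup>2)) + sqrt (D * (4 * (x * h))) + sqrt (D * (25 * (x' * h')))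
     = sqrt D * (2 * r + 2 * sqrt (x * h) + 5 * sqrt (x' * h'))"
    using assms by (simp add: real_sqrt_mult algebra_simps)
  finally show ?thesis by simp
qed

text \<open>Chains start at zero and pass through the centres of the cover of radius \<open>x j\<close> at level \<open>j + 1\<close>.  The
  bound for chains of length \<open>L + 1\<close> has the error \<open>(1 / 4) ^ L\<close>, which disappears as \<open>L\<close> grows.\<close>

lemma rademacher_entropy_bound:
  fixes v :: "'f \<Rightarrow> nat \<Rightarrow> real" and a :: "nat \<Rightarrow> real" and x h :: "nat \<Rightarrow> real"
  assumes n: "n > 0" and K: "K > 0" and D: "D \<ge> 1"
    and env: "\<And>f i. f \<in> F \<Longrightarrow> i < n \<Longrightarrow> \<bar>v f i\<bar> \<le> a i" and aK: "\<And>i. i < n \<Longrightarrow> a i \<le> K"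
    and x: "\<And>j. (1 / 4) ^ Suc j < x j" "\<And>j. x j \<le> (1 / 4) ^ j"
    and h: "\<And>j. h j \<ge> 0" and S: "\<And>L. (\<Sum>j<L. sqrt (x j * h j)) \<le> S"
    and cover: "\<And>j. \<exists>G. finite G \<and> (\<forall>f\<in>F. \<exists>g\<in>G. (\<Sum>i<n. \<bar>v f i - g i\<bar>) \<le> n * x j)
                      \<and> ln (real (card G)) \<le> D * h j"
  shows "(\<Sum>e\<in>signs n. SUP f\<in>F. ennreal \<bar>\<Sum>i<n. e i * v f i\<bar>)
     \<le> ennreal (2 ^ n * (n * (chaining_constant S * sqrt (K * D / n) * (1 + (\<Sum>i<n. a i) / n))))"
    (is "?Z \<le> ennreal ?R")
proof (cases "F = {}")
  case True
  then show ?thesis by (simp add: bot_ennreal)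
next
  case ne: False
  then obtain f0 where f0: "f0 \<in> F" by auto
  have a: "a i \<ge> 0" if "i < n" for i using env[OF f0 that] by simp
  define A where "A = (\<Sum>i<n. a i) / n"
  have A: "A \<ge> 0" using a by (auto simp: A_def intro!: sum_nonneg divide_nonneg_nonneg)
  obtain G where G: "\<And>j. finite (G j)"
      "\<And>j f. f \<in> F \<Longrightarrow> \<exists>g\<in>G j. (\<Sum>i<n. \<bar>v f i - g i\<bar>) \<le> n * x j"
      "\<And>j. ln (real (card (G j))) \<le> D * h j"
    using cover by metis
  define p where "p j f = (SOME g. g \<in> G j \<and> (\<Sum>i<n. \<bar>v f i - g i\<bar>) \<le> n * x j)" for j f
  have p: "p j f \<in> G j \<and> (\<Sum>i<n. \<bar>v f i - p j f i\<bar>) \<le> n * x j" if "f \<in> F" for j f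
    using someI_ex[of "\<lambda>g. g \<in> G j \<and> (\<Sum>i<n. \<bar>v f i - g i\<bar>) \<le> n * x j"] G(2)[OF that, of j]
    unfolding p_def by blast
  \<comment> \<open>Clipping the centres to the envelope brings them no further from the class and bounds them by \<open>K\<close>.\<close>
  define clip where "clip g i = (if i < n then max (- a i) (min (a i) (g i)) else 0)"
    for g :: "nat \<Rightarrow> real" and i
  define \<pi> where "\<pi> j f = (case j of 0 \<Rightarrow> (\<lambda>_. 0) | Suc k \<Rightarrow> clip (p k f))" for j f
  define E where "E j = (case j of 0 \<Rightarrow> 0 | Suc k \<Rightarrow> D * h k)" for j
  define \<delta> where "\<delta> j = (case j of 0 \<Rightarrow> A + x 0 | Suc k \<Rightarrow> x (Suc k) + x k)" for j
  have xpos: "x j > 0" for j using x(1)[of j] by (rule less_trans[rotated]) simp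
  have close: "(\<Sum>i<n. \<bar>v f i - clip (p j f) i\<bar>) \<le> n * x j" if f: "f \<in> F" for f j
  proof -
    have "\<bar>v f i - clip (p j f) i\<bar> \<le> \<bar>v f i - p j f i\<bar>" if "i < n" for i
      using env[OF f that] that by (auto simp: clip_def max_def min_def)
    hence "(\<Sum>i<n. \<bar>v f i - clip (p j f) i\<bar>) \<le> (\<Sum>i<n. \<bar>v f i - p j f i\<bar>)"
      by (intro sum_mono) auto
    thus ?thesis using p[OF f, of j] by linarith
  qed
  have clip_bounded: "\<bar>clip g i\<bar> \<le> K" for g i
    using a[of i] aK[of i] K by (auto simp: clip_def max_def min_def)
  have bound: "?Z \<le> ennreal (2 ^ n * (n * (2 * sqrt (K / n) * (sqrt D * ((1 + A) * (5 + 9 * S))) + (1 / 4) ^ L)))"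
    for L :: nat
  proof -
    have "\<exists>X. (\<forall>e\<in>signs n. \<forall>f\<in>F. \<bar>\<Sum>i<n. e i * v f i\<bar> \<le> X e) \<and> (\<Sum>e\<in>signs n. X e)
       \<le> 2 ^ n * (n * (2 * sqrt (K / n) * (\<Sum>j<Suc L. sqrt (\<delta> j * (ln 2 + E j + E (Suc j)))) + x L))"
    proof (rule rademacher_chaining[where F = F and K = K and \<pi> = \<pi> and L = "Suc L" and E = E and \<delta> = \<delta>
            and v = v and n = n and \<epsilon> = "x L"])
      show "\<bar>\<pi> j f i\<bar> \<le> K" for j f i
        using clip_bounded K by (auto simp: \<pi>_def split: nat.split)
      have img: "\<pi> (Suc k) ` F \<subseteq> clip ` G k" for k using p by (auto simp: \<pi>_def)
      have img0: "\<pi> 0 ` F = {\<lambda>_. 0}" using ne by (auto simp: \<pi>_def)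
      show fin: "finite (\<pi> j ` F)" for j
      proof (cases j)
        case (Suc k)
        show ?thesis unfolding Suc by (rule finite_subset[OF img]) (simp add: G)
      qed (simp add: img0)
      show "ln (real (card (\<pi> j ` F))) \<le> E j" for j
      proof (cases j)
        case (Suc k)
        have "card (\<pi> j ` F) \<le> card (clip ` G k)"
          unfolding Suc by (intro card_mono img) (simp add: G)
        also have "\<dots> \<le> card (G k)" by (intro card_image_le G)
        finally have le: "real (card (\<pi> j ` F)) \<le> real (card (G k))" by simp
        moreover have "card (\<pi> j ` F) > 0" using fin[of j] ne by (simp add: card_gt_0_iff)
        ultimately have "ln (real (card (\<pi> j ` F))) \<le> ln (real (card (G k)))" by simp
        thus ?thesis using G(3)[of k] by (simp add: E_def Suc)
      qed (simp add: img0 E_def)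
      show "\<delta> j > 0" for j using A xpos by (auto simp: \<delta>_def add_nonneg_pos add_pos_pos split: nat.split)
      show "(\<Sum>i<n. \<bar>\<pi> (Suc j) f i - \<pi> j f i\<bar>) \<le> n * \<delta> j" if f: "f \<in> F" for j f
      proof (cases j)
        case 0
        have "(\<Sum>i<n. \<bar>\<pi> (Suc j) f i - \<pi> j f i\<bar>) \<le> (\<Sum>i<n. \<bar>v f i - clip (p 0 f) i\<bar> + a i)"
          by (intro sum_mono) (use env[OF f] in \<open>fastforce simp: 0 \<pi>_def\<close>)
        also have "\<dots> \<le> n * x 0 + n * A"
          using close[OF f, of 0] n by (simp add: sum.distrib A_def)
        finally show ?thesis by (simp add: 0 \<delta>_def algebra_simps)
      next
        case (Suc k)
        have "(\<Sum>i<n. \<bar>\<pi> (Suc j) f i - \<pi> j f i\<bar>)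
           \<le> (\<Sum>i<n. \<bar>v f i - clip (p j f) i\<bar> + \<bar>v f i - clip (p k f) i\<bar>)"
          by (intro sum_mono) (simp add: Suc \<pi>_def)
        also have "\<dots> \<le> n * x j + n * x k"
          using close[OF f, of j] close[OF f, of k] by (simp add: sum.distrib)
        finally show ?thesis by (simp add: Suc \<delta>_def algebra_simps)
      qed
      show "(\<Sum>i<n. \<bar>v f i - \<pi> (Suc L) f i\<bar>) \<le> n * x L" if "f \<in> F" for f
        using close[OF that, of L] by (simp add: \<pi>_def)
    next
      fix X
      assume "\<And>e f. e \<in> signs n \<Longrightarrow> f \<in> F \<Longrightarrow> \<bar>\<Sum>i<n. e i * v f i\<bar> \<le> X e"
        and "(\<Sum>e\<in>signs n. X e)
         \<le> 2 ^ n * (n * (2 * sqrt (K / n) * (\<Sum>j<Suc L. sqrt (\<delta> j * (ln 2 + E j + E (Suc j)))) + x L))"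
      thus "\<exists>X. (\<forall>e\<in>signs n. \<forall>f\<in>F. \<bar>\<Sum>i<n. e i * v f i\<bar> \<le> X e) \<and> (\<Sum>e\<in>signs n. X e)
         \<le> 2 ^ n * (n * (2 * sqrt (K / n) * (\<Sum>j<Suc L. sqrt (\<delta> j * (ln 2 + E j + E (Suc j)))) + x L))"
        by blast
    qed (use ne n K in \<open>auto simp: \<pi>_def\<close>)
    then obtain X where X: "\<And>e f. e \<in> signs n \<Longrightarrow> f \<in> F \<Longrightarrow> \<bar>\<Sum>i<n. e i * v f i\<bar> \<le> X e"
      "(\<Sum>e\<in>signs n. X e)
         \<le> 2 ^ n * (n * (2 * sqrt (K / n) * (\<Sum>j<Suc L. sqrt (\<delta> j * (ln 2 + E j + E (Suc j)))) + x L))"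
      by blast
    have S0: "S \<ge> 0" using S[of 0] by simp
    have "(\<Sum>j<Suc L. sqrt (\<delta> j * (ln 2 + E j + E (Suc j))))
      = sqrt ((A + x 0) * (ln 2 + D * h 0))
        + (\<Sum>j<L. sqrt ((x (Suc j) + x j) * (ln 2 + D * h j + D * h (Suc j))))"
      by (simp only: sum.lessThan_Suc_shift) (simp add: \<delta>_def E_def)
    also have "\<dots> \<le> sqrt D * ((1 + A) * (1 + 2 * sqrt (x 0 * h 0)))
        + (\<Sum>j<L. sqrt D * (2 * (1 / 2) ^ j + 2 * sqrt (x j * h j) + 5 * sqrt (x (Suc j) * h (Suc j))))"
    proof (intro add_mono sum_mono)
      show "sqrt ((A + x 0) * (ln 2 + D * h 0)) \<le> sqrt D * ((1 + A) * (1 + 2 * sqrt (x 0 * h 0)))"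
        using x(1)[of 0] x(2)[of 0] by (intro link_cost_first) (auto simp: D A h)
      fix j
      have 1: "x (Suc j) \<le> x j"
        using x(1)[of j] x(2)[of "Suc j"] by linarith
      have 2: "x j \<le> 16 * x (Suc j)"
        using x(1)[of "Suc j"] x(2)[of "j"] by simp
      have 3: "x j \<le> ((1 / 2) ^ j)\<^sup>2"
        using x(2)[of j] by (simp add: power2_eq_square flip: power_mult_distrib)
      show "sqrt ((x (Suc j) + x j) * (ln 2 + D * h j + D * h (Suc j)))
         \<le> sqrt D * (2 * (1 / 2) ^ j + 2 * sqrt (x j * h j) + 5 * sqrt (x (Suc j) * h (Suc j)))"
        by (intro link_cost_next) (use D h xpos 1 2 3 in auto)
    qed
    also have "\<dots> = sqrt D * ((1 + A) * (1 + 2 * sqrt (x 0 * h 0)) + (2 * (\<Sum>j<L. (1 / 2) ^ j)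
        + 2 * (\<Sum>j<L. sqrt (x j * h j)) + 5 * (\<Sum>j<L. sqrt (x (Suc j) * h (Suc j)))))"
      by (simp add: sum.distrib sum_distrib_left distrib_left)
    also have "\<dots> \<le> sqrt D * ((1 + A) * (1 + 2 * S) + (1 + A) * (4 + 7 * S))"
    proof (intro mult_left_mono add_mono)
      show "sqrt (x 0 * h 0) \<le> S" using S[of 1] by simp
      have "(\<Sum>j<Suc L. sqrt (x j * h j)) = sqrt (x 0 * h 0) + (\<Sum>j<L. sqrt (x (Suc j) * h (Suc j)))"
        by (simp only: sum.lessThan_Suc_shift)
      hence "(\<Sum>j<L. sqrt (x (Suc j) * h (Suc j))) \<le> S"
        using S[of "Suc L"] real_sqrt_ge_zero[of "x 0 * h 0"] mult_nonneg_nonneg[OF less_imp_le[OF xpos] h, of 0 0]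
        by linarith
      moreover have "(\<Sum>j<L. (1 / 2 :: real) ^ j) \<le> 2"
        by (simp add: sum_gp_strict)
      ultimately have "2 * (\<Sum>j<L. (1 / 2) ^ j) + 2 * (\<Sum>j<L. sqrt (x j * h j))
          + 5 * (\<Sum>j<L. sqrt (x (Suc j) * h (Suc j))) \<le> 4 + 7 * S"
        using S[of L] by linarith
      also have "\<dots> \<le> (1 + A) * (4 + 7 * S)"
        using A S0 mult_right_mono[of 1 "1 + A" "4 + 7 * S"] by simp
      finally show "2 * (\<Sum>j<L. (1 / 2) ^ j) + 2 * (\<Sum>j<L. sqrt (x j * h j))
          + 5 * (\<Sum>j<L. sqrt (x (Suc j) * h (Suc j))) \<le> (1 + A) * (4 + 7 * S)" .
    qed (use A D in auto)
    also have "\<dots> = sqrt D * ((1 + A) * (5 + 9 * S))" by (simp add: algebra_simps)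
    finally have links: "(\<Sum>j<Suc L. sqrt (\<delta> j * (ln 2 + E j + E (Suc j)))) \<le> \<dots>" .
    have X0: "0 \<le> X e" if "e \<in> signs n" for e using X(1)[OF that f0] by linarith
    have "?Z \<le> (\<Sum>e\<in>signs n. ennreal (X e))"
      by (intro sum_mono SUP_least ennreal_leI X(1))
    also have "\<dots> = ennreal (\<Sum>e\<in>signs n. X e)"
      by (intro sum_ennreal X0)
    also have "\<dots> \<le> ennreal (2 ^ n * (n * (2 * sqrt (K / n) * (sqrt D * ((1 + A) * (5 + 9 * S))) + (1 / 4) ^ L)))"
      by (intro ennreal_leI order.trans[OF X(2)] mult_left_mono add_mono links x(2)) (use K in auto)
    finally show ?thesis .
  qed
  have "(\<lambda>L. ennreal (2 ^ n * (n * (2 * sqrt (K / n) * (sqrt D * ((1 + A) * (5 + 9 * S))) + (1 / 4) ^ L))))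
     \<longlonglongrightarrow> ennreal (2 ^ n * (n * (2 * sqrt (K / n) * (sqrt D * ((1 + A) * (5 + 9 * S))) + 0)))"
    by (intro tendsto_intros LIMSEQ_power_zero) simp
  hence "?Z \<le> ennreal (2 ^ n * (n * (2 * sqrt (K / n) * (sqrt D * ((1 + A) * (5 + 9 * S))) + 0)))"
    by (rule LIMSEQ_le_const) (use bound in blast)
  also have "2 * sqrt (K / n) * (sqrt D * ((1 + A) * (5 + 9 * S))) + 0
     = chaining_constant S * sqrt (K * D / n) * (1 + A)"
    by (simp add: chaining_constant_def real_sqrt_mult real_sqrt_divide)
  finally show ?thesis by (simp only: A_def)
qed

section \<open>Symmetrization\<close>

lemma outer_expectation_le:
  assumes "U \<in> borel_measurable M" "\<And>\<omega>. \<omega> \<in> space M \<Longrightarrow> Z \<omega> \<le> U \<omega>"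
  shows "outer_expectation M Z \<le> (\<integral>\<^sup>+\<omega>. U \<omega> \<partial>M)"
  unfolding outer_expectation_def by (rule INF_lower) (use assms in auto)

lemma completion_measurable_majorant:
  fixes Z :: "'a \<Rightarrow> ennreal"
  assumes "Z \<in> borel_measurable (completion M)"
  obtains U where "U \<in> borel_measurable M" "\<And>x. x \<in> space M \<Longrightarrow> Z x \<le> U x" "AE x in M. U x = Z x"
proof -
  obtain g where g [measurable]: "g \<in> borel_measurable M" and eq: "AE x in M. Z x = g x"
    using completion_ex_borel_measurable[OF assms] by blast
  obtain N where N: "{x \<in> space M. Z x \<noteq> g x} \<subseteq> N" "N \<in> null_sets M"
    using eq unfolding eventually_ae_filter by blast
  have [measurable]: "N \<in> sets M" using N by auto
  show ?thesis
  proof (rule that[of "\<lambda>x. if x \<in> N then top else g x"])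
    show "AE x in M. (if x \<in> N then top else g x) = Z x"
      using AE_not_in[OF N(2)] eq by eventually_elim simp
    show "(\<lambda>x. if x \<in> N then top else g x) \<in> borel_measurable M"
      by measurable
    show "Z x \<le> (if x \<in> N then top else g x)" if "x \<in> space M" for x
      using N(1) that by (cases "x \<in> N") auto
  qed
qed

lemma measurable_sample_space_component:
  "i < n \<Longrightarrow> (\<lambda>\<xi>. \<xi> i) \<in> sample_space n P \<rightarrow>\<^sub>M P"
  unfolding sample_space_def by (intro measurable_component_singleton) auto

text \<open>The set of those \<open>i\<close> with \<open>\<xi> i \<in> A\<close> takes finitely many values, each on a measurable set of samples.
  On each of these the cut-off merely sets some of the weights to zero.\<close>

lemma P_measurable_class_restrict:
  assumes F: "P_measurable_class P F" and A: "A \<in> sets P"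
  shows "P_measurable_class P ((\<lambda>f x. f x * indicator A x) ` F)"
  unfolding P_measurable_class_def
proof (intro allI)
  fix m and e :: "nat \<Rightarrow> real"
  define M where "M = completion (sample_space m P)"
  define g where "g \<xi> = {i. i < m \<and> \<xi> i \<in> A}" for \<xi> :: "nat \<Rightarrow> 'a"
  define Z where "Z S \<xi> = (SUP f\<in>F. ennreal \<bar>\<Sum>i<m. (if i \<in> S then e i else 0) * f (\<xi> i)\<bar>)"
    for S :: "nat set" and \<xi> :: "nat \<Rightarrow> 'a"
  have "(\<lambda>\<xi>. Z (g \<xi>) \<xi>) \<in> borel_measurable M"
  proof (rule measurable_compose_countable'[where I = "Pow {..<m}"])
    show "Z S \<in> borel_measurable M" for S
      using F[unfolded P_measurable_class_def, THEN spec[of _ m],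
          THEN spec[of _ "\<lambda>i. if i \<in> S then e i else 0"]]
      unfolding Z_def M_def .
    have comp: "{\<xi> \<in> space M. \<xi> i \<in> A} \<in> sets M" if "i < m" for i
    proof -
      note [measurable] = measurable_sample_space_component[OF that, of P]
      have "{\<xi> \<in> space (sample_space m P). \<xi> i \<in> A} \<in> sets (sample_space m P)"
        using A by measurable
      thus ?thesis by (simp add: M_def)
    qed
    have "g -` {S} \<inter> space M \<in> sets M" if S: "S \<subseteq> {..<m}" for S
    proof -
      have "g \<xi> = S \<longleftrightarrow> (\<forall>i\<in>{..<m}. \<xi> i \<in> A \<longleftrightarrow> i \<in> S)" for \<xi>
        unfolding g_def using S by blast
      hence "g -` {S} \<inter> space M = {\<xi> \<in> space M. \<forall>i\<in>{..<m}. \<xi> i \<in> A \<longleftrightarrow> i \<in> S}"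
        by (simp add: vimage_def Int_def conj_commute)
      also have "\<dots> \<in> sets M"
      proof (rule sets.sets_Collect_finite_All)
        fix i assume "i \<in> {..<m}"
        thus "{\<xi> \<in> space M. \<xi> i \<in> A \<longleftrightarrow> i \<in> S} \<in> sets M"
          using comp[of i] sets.sets_Collect_neg[OF comp[of i]] by (cases "i \<in> S") simp_all
      qed auto
      finally show ?thesis .
    qed
    thus "g \<in> measurable M (count_space (Pow {..<m}))"
      by (subst measurable_count_space_eq2) (auto simp: g_def)
  qed (auto intro: countable_finite)
  also have "(\<lambda>\<xi>. Z (g \<xi>) \<xi>) = (\<lambda>\<xi>. SUP f\<in>(\<lambda>f x. f x * indicator A x) ` F. ennreal \<bar>\<Sum>i<m. e i * f (\<xi> i)\<bar>)"
    unfolding Z_def image_image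
    by (intro ext SUP_cong refl arg_cong[where f = ennreal] arg_cong[where f = abs] sum.cong)
       (auto simp: g_def indicator_def)
  finally show "(\<lambda>\<xi>. SUP f\<in>(\<lambda>f x. f x * indicator A x) ` F. ennreal \<bar>\<Sum>i<m. e i * f (\<xi> i)\<bar>)
       \<in> borel_measurable (completion (sample_space m P))"
    by (simp only: M_def)
qed

lemma integral_empirical_measure:
  fixes f :: "'a \<Rightarrow> real"
  assumes "n > 0" "\<xi> \<in> space (sample_space n P)" "f \<in> borel_measurable P"
  shows "(\<integral>x. f x \<partial>empirical_measure P n \<xi>) = (\<Sum>i<n. f (\<xi> i)) / n"
proof -
  have "\<xi> \<in> measurable (uniform_count_measure {..<n}) P"
    using assms(2) by (auto simp: measurable_def sample_space_def space_PiM space_uniform_count_measure sets_uniform_count_measure PiE_iff)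
  thus ?thesis
    using assms unfolding empirical_measure_def
    by (simp add: integral_distr integral_uniform_count_measure)
qed

lemma prob_space_sample_space: "prob_space P \<Longrightarrow> prob_space (sample_space n P)"
  unfolding sample_space_def by (rule prob_space_PiM)

lemma distr_sample_space_component:
  assumes "prob_space P" "i < n"
  shows "distr (sample_space n P) P (\<lambda>\<xi>. \<xi> i) = P"
  unfolding sample_space_def using assms by (intro distr_PiM_component) auto

lemma integral_sample_space_component:
  fixes f :: "'a \<Rightarrow> real"
  assumes "prob_space P" "i < n" "integrable P f"
  shows "integrable (sample_space n P) (\<lambda>\<xi>. f (\<xi> i))"
    and "(\<integral>\<xi>. f (\<xi> i) \<partial>sample_space n P) = (\<integral>x. f x \<partial>P)"
proof -
  note d = distr_sample_space_component[OF assms(1,2)]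
  note [measurable] = measurable_sample_space_component[OF assms(2), of P]
  have [measurable]: "f \<in> borel_measurable P" using assms by auto
  show "integrable (sample_space n P) (\<lambda>\<xi>. f (\<xi> i))"
    using integrable_distr_eq[of "\<lambda>\<xi>. \<xi> i" "sample_space n P" P f] assms d by simp
  show "(\<integral>\<xi>. f (\<xi> i) \<partial>sample_space n P) = (\<integral>x. f x \<partial>P)"
    using integral_distr[of "\<lambda>\<xi>. \<xi> i" "sample_space n P" P f] assms d by simp
qed

text \<open>Exchanges coordinates between a sample and a ghost sample.  The restriction to the indices makes the
  result a point of the product space again.\<close>

definition mix :: "nat \<Rightarrow> nat set \<Rightarrow> (nat \<Rightarrow> 'a) \<Rightarrow> (nat \<Rightarrow> 'a) \<Rightarrow> nat \<Rightarrow> 'a" where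
  "mix n S \<xi> \<eta> = (\<lambda>i\<in>{..<n}. if i \<in> S then \<xi> i else \<eta> i)"

lemma measurable_mix [measurable]:
  "(\<lambda>(\<xi>, \<eta>). mix n S \<xi> \<eta>) \<in> sample_space n P \<Otimes>\<^sub>M sample_space n P \<rightarrow>\<^sub>M sample_space n P"
proof -
  have "(\<lambda>p. \<lambda>i\<in>{..<n}. if i \<in> S then fst p i else snd p i)
      \<in> sample_space n P \<Otimes>\<^sub>M sample_space n P \<rightarrow>\<^sub>M Pi\<^sub>M {..<n} (\<lambda>_. P)"
  proof (rule measurable_restrict)
    fix i assume "i \<in> {..<n}"
    hence [measurable]: "(\<lambda>\<xi>. \<xi> i) \<in> sample_space n P \<rightarrow>\<^sub>M P"
      by (intro measurable_sample_space_component) simp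
    show "(\<lambda>p. if i \<in> S then fst p i else snd p i)
        \<in> sample_space n P \<Otimes>\<^sub>M sample_space n P \<rightarrow>\<^sub>M P"
      by (cases "i \<in> S") (simp_all, measurable)
  qed
  thus ?thesis unfolding mix_def case_prod_beta sample_space_def[of n P, symmetric] .
qed

lemma distr_mix:
  assumes "prob_space P"
  shows "distr (sample_space n P \<Otimes>\<^sub>M sample_space n P) (sample_space n P) (\<lambda>(\<xi>, \<eta>). mix n S \<xi> \<eta>)
           = sample_space n P" (is "?D = _")
proof -
  interpret P: prob_space P by fact
  interpret product_sigma_finite "\<lambda>_. P" ..
  interpret M: prob_space "sample_space n P" using assms by (rule prob_space_sample_space)
  have "?D = Pi\<^sub>M {..<n} (\<lambda>_. P)"
  proof (rule PiM_eqI)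
    fix A assume A: "\<And>i. i \<in> {..<n} \<Longrightarrow> A i \<in> sets P"
    define A1 where "A1 i = (if i \<in> S then A i else space P)" for i
    define A2 where "A2 i = (if i \<in> S then space P else A i)" for i
    have A12: "A1 i \<in> sets P" "A2 i \<in> sets P" if "i \<in> {..<n}" for i
      using A[OF that] by (auto simp: A1_def A2_def)
    have sub: "y \<in> space P" if "y \<in> A i" "i < n" for i y
      using A[of i] sets.sets_into_space that by blast
    have pre: "(\<lambda>(\<xi>, \<eta>). mix n S \<xi> \<eta>) -` Pi\<^sub>E {..<n} A \<inter> space (sample_space n P \<Otimes>\<^sub>M sample_space n P)
        = Pi\<^sub>E {..<n} A1 \<times> Pi\<^sub>E {..<n} A2"
    proof (rule set_eqI)
      fix p :: "(nat \<Rightarrow> 'a) \<times> (nat \<Rightarrow> 'a)"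
      obtain \<xi> \<eta> where p: "p = (\<xi>, \<eta>)" by fastforce
      have key: "(\<xi> i \<in> space P \<and> \<eta> i \<in> space P \<and> (if i \<in> S then \<xi> i else \<eta> i) \<in> A i)
          \<longleftrightarrow> (\<xi> i \<in> A1 i \<and> \<eta> i \<in> A2 i)" if "i < n" for i
        using sub[of "\<xi> i" i] sub[of "\<eta> i" i] that by (auto simp: A1_def A2_def)
      have "p \<in> (\<lambda>(\<xi>, \<eta>). mix n S \<xi> \<eta>) -` Pi\<^sub>E {..<n} A \<inter> space (sample_space n P \<Otimes>\<^sub>M sample_space n P)
         \<longleftrightarrow> \<xi> \<in> extensional {..<n} \<and> \<eta> \<in> extensional {..<n} \<and>
           (\<forall>i\<in>{..<n}. \<xi> i \<in> space P \<and> \<eta> i \<in> space P \<and> (if i \<in> S then \<xi> i else \<eta> i) \<in> A i)"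
        unfolding p vimage_def mix_def
        by (simp add: space_pair_measure sample_space_def space_PiM PiE_iff) blast
      also have "\<dots> \<longleftrightarrow> p \<in> Pi\<^sub>E {..<n} A1 \<times> Pi\<^sub>E {..<n} A2"
        unfolding p by (simp add: key PiE_iff) blast
      finally show "p \<in> (\<lambda>(\<xi>, \<eta>). mix n S \<xi> \<eta>) -` Pi\<^sub>E {..<n} A \<inter> space (sample_space n P \<Otimes>\<^sub>M sample_space n P)
         \<longleftrightarrow> p \<in> Pi\<^sub>E {..<n} A1 \<times> Pi\<^sub>E {..<n} A2" .
    qed
    have box: "Pi\<^sub>E {..<n} A' \<in> sets (sample_space n P)" if "\<And>i. i \<in> {..<n} \<Longrightarrow> A' i \<in> sets P" for A'
      unfolding sample_space_def by (intro sets_PiM_I_finite that) auto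
    have "emeasure ?D (Pi\<^sub>E {..<n} A) = emeasure (sample_space n P \<Otimes>\<^sub>M sample_space n P) (Pi\<^sub>E {..<n} A1 \<times> Pi\<^sub>E {..<n} A2)"
      by (subst emeasure_distr) (auto intro!: box A simp: pre)
    also have "\<dots> = emeasure (sample_space n P) (Pi\<^sub>E {..<n} A1) * emeasure (sample_space n P) (Pi\<^sub>E {..<n} A2)"
      by (intro M.emeasure_pair_measure_Times box A12)
    also have "\<dots> = (\<Prod>i<n. emeasure P (A1 i)) * (\<Prod>i<n. emeasure P (A2 i))"
      unfolding sample_space_def
      by (intro arg_cong2[where f = "(*)"] emeasure_PiM) (auto intro: A12)
    also have "\<dots> = (\<Prod>i<n. emeasure P (A i))"
      unfolding prod.distrib[symmetric]
      by (intro prod.cong refl) (auto simp: A1_def A2_def P.emeasure_space_1)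
    finally show "emeasure ?D (Pi\<^sub>E {..<n} A) = (\<Prod>i<n. emeasure P (A i))" .
  qed (auto simp: sample_space_def)
  thus ?thesis by (simp add: sample_space_def)
qed

lemma nn_integral_mix:
  assumes "prob_space P" and [measurable]: "h \<in> borel_measurable (sample_space n P)"
  shows "(\<integral>\<^sup>+\<xi>. \<integral>\<^sup>+\<eta>. h (mix n S \<xi> \<eta>) \<partial>sample_space n P \<partial>sample_space n P) = (\<integral>\<^sup>+\<xi>. h \<xi> \<partial>sample_space n P)"
proof -
  let ?M = "sample_space n P"
  interpret M: prob_space ?M using assms(1) by (rule prob_space_sample_space)
  have "(\<integral>\<^sup>+\<xi>. h \<xi> \<partial>?M) = (\<integral>\<^sup>+\<xi>. h \<xi> \<partial>distr (?M \<Otimes>\<^sub>M ?M) ?M (\<lambda>(\<xi>, \<eta>). mix n S \<xi> \<eta>))"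
    by (simp only: distr_mix[OF assms(1)])
  also have "\<dots> = (\<integral>\<^sup>+p. h ((\<lambda>(\<xi>, \<eta>). mix n S \<xi> \<eta>) p) \<partial>(?M \<Otimes>\<^sub>M ?M))"
    by (intro nn_integral_distr) auto
  also have "\<dots> = (\<integral>\<^sup>+\<xi>. \<integral>\<^sup>+\<eta>. h (mix n S \<xi> \<eta>) \<partial>?M \<partial>?M)"
    by (subst M.nn_integral_fst[symmetric]) (auto intro: measurable_compose[OF measurable_mix])
  finally show ?thesis by simp
qed

text \<open>Exchanging the two samples at the indices with sign \<open>-1\<close> turns plain differences into signed ones.\<close>

lemma sum_swap_difference:
  fixes g :: "'a \<Rightarrow> real"
  assumes e: "e \<in> signs n"
  shows "(\<Sum>i<n. g (\<xi> i) - g (\<eta> i))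
    = (\<Sum>i<n. e i * g (mix n {i. e i = 1} \<xi> \<eta> i)) - (\<Sum>i<n. e i * g (mix n {i. e i \<noteq> 1} \<xi> \<eta> i))"
  unfolding sum_subtractf[symmetric]
proof (intro sum.cong refl)
  fix i assume i: "i \<in> {..<n}"
  have "e i \<in> {-1, 1}"
    by (rule PiE_mem[OF e[unfolded signs_def]]) (rule i)
  thus "g (\<xi> i) - g (\<eta> i) = e i * g (mix n {i. e i = 1} \<xi> \<eta> i) - e i * g (mix n {i. e i \<noteq> 1} \<xi> \<eta> i)"
    using i by (auto simp: mix_def)
qed

text \<open>For each sign vector the deviation between the sample and a ghost sample is at most the sum of two
  Rademacher suprema, evaluated at two mixtures of the samples, each of which is again distributed like the
  sample.  The majorant is the average over the signs, integrated over the ghost sample.  The suprema enter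
  through majorants \<open>Y e\<close> that are measurable before completion, since only for these do Fubini's theorem
  and the transformation by the mixing map apply.\<close>

lemma symmetrization:
  assumes "prob_space P" and n: "n > 0" and meas: "P_measurable_class P G"
    and int: "\<And>g. g \<in> G \<Longrightarrow> integrable P g"
  obtains U where "U \<in> borel_measurable (sample_space n P)"
    and "\<And>\<xi>. \<xi> \<in> space (sample_space n P) \<Longrightarrow> sup_deviation (empirical_measure P n \<xi>) P G \<le> U \<xi>"
    and "(\<integral>\<^sup>+\<xi>. U \<xi> \<partial>sample_space n P) = ennreal (2 / (real n * 2 ^ n)) *
      (\<integral>\<^sup>+\<xi>. (\<Sum>e\<in>signs n. SUP g\<in>G. ennreal \<bar>\<Sum>i<n. e i * g (\<xi> i)\<bar>) \<partial>sample_space n P)"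
proof -
  define M where "M = sample_space n P"
  interpret M: prob_space M unfolding M_def using assms(1) by (rule prob_space_sample_space)
  define Z where "Z e \<xi> = (SUP g\<in>G. ennreal \<bar>\<Sum>i<n. e i * g (\<xi> i)\<bar>)" for e :: "nat \<Rightarrow> real" and \<xi>
  have "\<exists>Y\<in>borel_measurable M. (\<forall>\<xi>\<in>space M. Z e \<xi> \<le> Y \<xi>) \<and> (AE \<xi> in M. Y \<xi> = Z e \<xi>)" for e
  proof -
    have "Z e \<in> borel_measurable (completion M)"
      using meas[unfolded P_measurable_class_def, THEN spec[of _ n], THEN spec[of _ e]] unfolding Z_def M_def .
    thus ?thesis by (rule completion_measurable_majorant) blast
  qed
  then obtain Y where Y [measurable]: "\<And>e. Y e \<in> borel_measurable M"
    and ZY: "\<And>e \<xi>. \<xi> \<in> space M \<Longrightarrow> Z e \<xi> \<le> Y e \<xi>" and YZ: "\<And>e. AE \<xi> in M. Y e \<xi> = Z e \<xi>"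
    by metis
  define c where "c = ennreal (1 / (real n * 2 ^ n))"
  define W where "W \<xi> \<eta> = c * (\<Sum>e\<in>signs n. Y e (mix n {i. e i = 1} \<xi> \<eta>) + Y e (mix n {i. e i \<noteq> 1} \<xi> \<eta>))"
    for \<xi> \<eta>
  have mixM [measurable]: "(\<lambda>p. mix n S (fst p) (snd p)) \<in> M \<Otimes>\<^sub>M M \<rightarrow>\<^sub>M M" for S
    using measurable_mix[of n S P] by (simp add: case_prod_beta M_def)
  have mix_space: "mix n S \<xi> \<eta> \<in> space M" if "\<xi> \<in> space M" "\<eta> \<in> space M" for S \<xi> \<eta>
    using measurable_space[OF mixM, of "(\<xi>, \<eta>)" S] that by (simp add: space_pair_measure)
  have W: "ennreal (\<bar>\<Sum>i<n. g (\<xi> i) - g (\<eta> i)\<bar> / n) \<le> W \<xi> \<eta>"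
    if g: "g \<in> G" and \<xi>: "\<xi> \<in> space M" and \<eta>: "\<eta> \<in> space M" for g \<xi> \<eta>
  proof -
    have one: "ennreal \<bar>\<Sum>i<n. g (\<xi> i) - g (\<eta> i)\<bar> \<le> Y e (mix n {i. e i = 1} \<xi> \<eta>) + Y e (mix n {i. e i \<noteq> 1} \<xi> \<eta>)"
      if e: "e \<in> signs n" for e
    proof -
      have Zg: "ennreal \<bar>\<Sum>i<n. e i * g (\<zeta> i)\<bar> \<le> Y e \<zeta>" if "\<zeta> \<in> space M" for \<zeta>
        using ZY[OF that, of e] g unfolding Z_def by (rule order.trans[OF SUP_upper, rotated])
      have "ennreal \<bar>\<Sum>i<n. g (\<xi> i) - g (\<eta> i)\<bar>
          \<le> ennreal (\<bar>\<Sum>i<n. e i * g (mix n {i. e i = 1} \<xi> \<eta> i)\<bar> + \<bar>\<Sum>i<n. e i * g (mix n {i. e i \<noteq> 1} \<xi> \<eta> i)\<bar>)"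
        unfolding sum_swap_difference[OF e] by (intro ennreal_leI abs_triangle_ineq4)
      also have "\<dots> \<le> Y e (mix n {i. e i = 1} \<xi> \<eta>) + Y e (mix n {i. e i \<noteq> 1} \<xi> \<eta>)"
        by (subst ennreal_plus) (auto intro!: add_mono Zg mix_space \<xi> \<eta>)
      finally show ?thesis .
    qed
    have "ennreal (\<bar>\<Sum>i<n. g (\<xi> i) - g (\<eta> i)\<bar> / n) = ennreal (1 / (real n * 2 ^ n) * (2 ^ n * \<bar>\<Sum>i<n. g (\<xi> i) - g (\<eta> i)\<bar>))"
      by simp
    also have "\<dots> = c * (of_nat (2 ^ n) * ennreal \<bar>\<Sum>i<n. g (\<xi> i) - g (\<eta> i)\<bar>)"
      unfolding c_def by (subst ennreal_mult) (auto simp: ennreal_mult ennreal_power ennreal_numeral[symmetric] simp del: ennreal_numeral)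
    also have "\<dots> = c * (\<Sum>e\<in>signs n. ennreal \<bar>\<Sum>i<n. g (\<xi> i) - g (\<eta> i)\<bar>)"
      by (simp add: card_signs)
    also have "\<dots> \<le> W \<xi> \<eta>"
      unfolding W_def by (intro mult_left_mono sum_mono one) auto
    finally show ?thesis .
  qed
  have W_meas: "(\<lambda>p. W (fst p) (snd p)) \<in> borel_measurable (M \<Otimes>\<^sub>M M)"
    unfolding W_def by measurable
  show ?thesis
  proof (rule that[of "\<lambda>\<xi>. \<integral>\<^sup>+\<eta>. W \<xi> \<eta> \<partial>M", folded M_def])
    show "(\<lambda>\<xi>. \<integral>\<^sup>+\<eta>. W \<xi> \<eta> \<partial>M) \<in> borel_measurable M"
      using W_meas by (intro M.borel_measurable_nn_integral) (simp add: case_prod_beta)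
  next
    fix \<xi> assume \<xi>: "\<xi> \<in> space M"
    show "sup_deviation (empirical_measure P n \<xi>) P G \<le> (\<integral>\<^sup>+\<eta>. W \<xi> \<eta> \<partial>M)"
      unfolding sup_deviation_def
    proof (rule SUP_least)
      fix g assume g: "g \<in> G"
      have comp: "integrable M (\<lambda>\<eta>. g (\<eta> i))" "(\<integral>\<eta>. g (\<eta> i) \<partial>M) = (\<integral>x. g x \<partial>P)" if "i < n" for i
        unfolding M_def by (intro integral_sample_space_component assms(1) that int g)+
      have diff: "integrable M (\<lambda>\<eta>. (\<Sum>i<n. g (\<xi> i) - g (\<eta> i)) / n)"
        using comp(1) by (intro integrable_divide Bochner_Integration.integrable_sum Bochner_Integration.integrable_diff) auto
      have "(\<integral>\<eta>. (\<Sum>i<n. g (\<xi> i) - g (\<eta> i)) / n \<partial>M) = (\<Sum>i<n. g (\<xi> i) - (\<integral>x. g x \<partial>P)) / n"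
        using comp by (simp add: Bochner_Integration.integral_sum M.prob_space)
      also have "\<dots> = (\<integral>x. g x \<partial>empirical_measure P n \<xi>) - (\<integral>x. g x \<partial>P)"
        using n \<xi> int[OF g] by (simp add: integral_empirical_measure M_def sum_subtractf field_simps)
      finally have "ennreal \<bar>(\<integral>x. g x \<partial>empirical_measure P n \<xi>) - (\<integral>x. g x \<partial>P)\<bar>
          = ennreal (norm (\<integral>\<eta>. (\<Sum>i<n. g (\<xi> i) - g (\<eta> i)) / n \<partial>M))" by simp
      also have "\<dots> \<le> (\<integral>\<^sup>+\<eta>. norm ((\<Sum>i<n. g (\<xi> i) - g (\<eta> i)) / n) \<partial>M)"
        using diff by (rule integral_norm_bound_ennreal)
      also have "\<dots> \<le> (\<integral>\<^sup>+\<eta>. W \<xi> \<eta> \<partial>M)"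
        using W[OF g \<xi>] by (intro nn_integral_mono) simp
      finally show "ennreal \<bar>(\<integral>x. g x \<partial>empirical_measure P n \<xi>) - (\<integral>x. g x \<partial>P)\<bar> \<le> (\<integral>\<^sup>+\<eta>. W \<xi> \<eta> \<partial>M)" .
    qed
  next
    have mixed: "(\<integral>\<^sup>+\<xi>. \<integral>\<^sup>+\<eta>. Y e (mix n S \<xi> \<eta>) \<partial>M \<partial>M) = (\<integral>\<^sup>+\<xi>. Y e \<xi> \<partial>M)" for e S
      unfolding M_def by (rule nn_integral_mix[OF assms(1)]) (use Y[of e] in \<open>simp add: M_def\<close>)
    have [measurable]: "(\<lambda>\<eta>. Y e (mix n S \<xi> \<eta>)) \<in> borel_measurable M" if "\<xi> \<in> space M" for e S \<xi>
      using measurable_compose[OF measurable_Pair1'[OF that] measurable_compose[OF mixM Y]] by simp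
    have [measurable]: "(\<lambda>\<xi>. \<integral>\<^sup>+\<eta>. Y e (mix n S \<xi> \<eta>) \<partial>M) \<in> borel_measurable M" for e S
      using measurable_compose[OF mixM Y] by (intro M.borel_measurable_nn_integral) (simp add: case_prod_beta)
    have "(\<integral>\<^sup>+\<xi>. \<integral>\<^sup>+\<eta>. W \<xi> \<eta> \<partial>M \<partial>M) = (\<integral>\<^sup>+\<xi>. c * (\<Sum>e\<in>signs n. (\<integral>\<^sup>+\<eta>. Y e (mix n {i. e i = 1} \<xi> \<eta>) \<partial>M)
            + (\<integral>\<^sup>+\<eta>. Y e (mix n {i. e i \<noteq> 1} \<xi> \<eta>) \<partial>M)) \<partial>M)"
      unfolding W_def
      by (intro nn_integral_cong) (simp add: nn_integral_cmult nn_integral_sum nn_integral_add)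
    also have "\<dots> = c * (\<Sum>e\<in>signs n. (\<integral>\<^sup>+\<xi>. Y e \<xi> \<partial>M) + (\<integral>\<^sup>+\<xi>. Y e \<xi> \<partial>M))"
      by (simp add: nn_integral_cmult nn_integral_sum nn_integral_add mixed)
    also have "\<dots> = c * 2 * (\<integral>\<^sup>+\<xi>. (\<Sum>e\<in>signs n. Y e \<xi>) \<partial>M)"
      by (simp add: nn_integral_sum sum_distrib_left[symmetric] mult_2[symmetric] mult.assoc)
    also have "c * 2 = ennreal (2 / (real n * 2 ^ n))"
      unfolding c_def using ennreal_mult'[of 2 "1 / (real n * 2 ^ n)"] by (simp add: mult.commute)
    also have "(\<integral>\<^sup>+\<xi>. (\<Sum>e\<in>signs n. Y e \<xi>) \<partial>M) = (\<integral>\<^sup>+\<xi>. (\<Sum>e\<in>signs n. Z e \<xi>) \<partial>M)"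
    proof (rule nn_integral_cong_AE)
      \<comment> \<open>Here the measurability of the class gives equality, where a majorant alone would give the wrong inequality.\<close>
      have "AE \<xi> in M. \<forall>e\<in>signs n. Y e \<xi> = Z e \<xi>"
        by (intro AE_finite_allI) (auto intro: YZ)
      thus "AE \<xi> in M. (\<Sum>e\<in>signs n. Y e \<xi>) = (\<Sum>e\<in>signs n. Z e \<xi>)"
        by eventually_elim simp
    qed
    finally show "(\<integral>\<^sup>+\<xi>. \<integral>\<^sup>+\<eta>. W \<xi> \<eta> \<partial>M \<partial>M) = ennreal (2 / (real n * 2 ^ n)) *
      (\<integral>\<^sup>+\<xi>. (\<Sum>e\<in>signs n. SUP g\<in>G. ennreal \<bar>\<Sum>i<n. e i * g (\<xi> i)\<bar>) \<partial>M)"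
      by (simp only: Z_def)
  qed
qed

section \<open>Radii and covers for the empirical measures\<close>

lemma ln_of_nat_mono: "a \<le> b \<Longrightarrow> ln (real a) \<le> ln (real b)"
  by (cases "a = 0"; cases "b = 0") auto

lemma L1_cover_of_log_covering_number:
  assumes "L1_log_covering_number \<epsilon> F Q \<le> ereal r"
  obtains G where "L1_cover \<epsilon> F Q G" "ln (real (card G)) \<le> r"
proof -
  define N where "N = (\<lambda>G. enat (card G)) ` {G. L1_cover \<epsilon> F Q G}"
  have N: "L1_covering_number \<epsilon> F Q = Inf N"
    by (simp add: L1_covering_number_def N_def)
  obtain k where k: "L1_covering_number \<epsilon> F Q = enat k" "ln (real k) \<le> r"
    using assms unfolding L1_log_covering_number_def by (cases "L1_covering_number \<epsilon> F Q") auto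
  have "N \<noteq> {}"
  proof
    assume "N = {}"
    thus False using k(1) N by (simp add: top_enat_def)
  qed
  then obtain l where "l \<in> N" by blast
  hence "Inf N \<in> N" by (rule wellorder_InfI)
  hence "enat k \<in> N" using k(1) N by simp
  then obtain G where "L1_cover \<epsilon> F Q G" "card G = k" by (auto simp: N_def)
  thus ?thesis using that k(2) by blast
qed

text \<open>A function cannot exceed its mean everywhere; the margin \<open>\<epsilon>\<close> saves the discussion of strict
  inequalities between integrals.\<close>

lemma ex_le_set_average:
  fixes g :: "real \<Rightarrow> real"
  assumes "l < u" and g: "set_integrable lebesgue {l<..u} g" and "\<epsilon> > 0"
  obtains x where "l < x" "x \<le> u" "(u - l) * g x \<le> (LINT x:{l<..u}|lebesgue. g x) + \<epsilon>"
proof -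
  define a where "a = (LINT x:{l<..u}|lebesgue. g x)"
  have "\<exists>x\<in>{l<..u}. (u - l) * g x \<le> a + \<epsilon>"
  proof (rule ccontr)
    assume *: "\<not> ?thesis"
    have "(a + \<epsilon>) / (u - l) \<le> g x" if "x \<in> {l<..u}" for x
    proof -
      have "\<not> (u - l) * g x \<le> a + \<epsilon>" using * that by blast
      thus ?thesis using \<open>l < u\<close> by (simp add: divide_le_eq mult.commute)
    qed
    moreover have "set_integrable lebesgue {l<..u} (\<lambda>_. (a + \<epsilon>) / (u - l))"
      unfolding set_integrable_def using \<open>l < u\<close>
      by (intro integrable_scaleR_left integrable_real_indicator) auto
    ultimately have "(LINT x:{l<..u}|lebesgue. (a + \<epsilon>) / (u - l)) \<le> a"
      unfolding a_def using g by (intro set_integral_mono) auto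
    also have "(LINT x:{l<..u}|lebesgue. (a + \<epsilon>) / (u - l)) = a + \<epsilon>"
      unfolding set_lebesgue_integral_def using \<open>l < u\<close> by simp
    finally show False using \<open>\<epsilon> > 0\<close> by simp
  qed
  thus ?thesis using that unfolding a_def by auto
qed

text \<open>Choosing the radii where \<open>H\<close> is small compared with its average over an interval replaces the usual
  comparison of a sum with the entropy integral, which needs \<open>H\<close> to be monotone.  The margins
  \<open>(1 / 2) ^ j\<close> of the choices account for the summand \<open>4\<close>.\<close>

lemma entropy_scales:
  fixes H :: "real \<Rightarrow> real"
  assumes H: "\<And>x. x > 0 \<Longrightarrow> H x \<ge> 0"
    and int: "set_integrable lebesgue {0<..} (\<lambda>x. sqrt (H x / x))"
  obtains x :: "nat \<Rightarrow> real" where "\<And>j. (1 / 4) ^ Suc j < x j" "\<And>j. x j \<le> (1 / 4) ^ j"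
    and "\<And>L. (\<Sum>j<L. sqrt (x j * H (x j))) \<le> 2 * (LINT x:{0<..}|lebesgue. sqrt (H x / x)) + 4"
proof -
  define g where "g x = sqrt (H x / x)" for x
  define I :: "nat \<Rightarrow> real set" where "I j = {(1 / 4) ^ Suc j <.. (1 / 4) ^ j}" for j
  define a where "a j = (LINT x:I j|lebesgue. g x)" for j
  have I_sub: "I j \<subseteq> {0<..}" for j
    unfolding I_def by (auto intro: less_trans[rotated])
  have I_sets: "I j \<in> sets lebesgue" for j by (simp add: I_def)
  have I_int: "set_integrable lebesgue (I j) g" for j
    unfolding g_def by (rule set_integrable_subset[OF int _ I_sub]) (simp add: I_def)
  have "\<exists>x. (1 / 4) ^ Suc j < x \<and> x \<le> (1 / 4) ^ j \<and>
      ((1 / 4) ^ j - (1 / 4) ^ Suc j) * g x \<le> a j + (1 / 2) ^ j" for j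
  proof -
    have "(1 / 4 :: real) ^ Suc j < (1 / 4) ^ j" by simp
    thus ?thesis
      by (rule ex_le_set_average[where g = g and \<epsilon> = "(1 / 2) ^ j"])
         (use I_int[of j] in \<open>auto simp: I_def a_def\<close>)
  qed
  then obtain x where x: "\<And>j. (1 / 4) ^ Suc j < x j" "\<And>j. x j \<le> (1 / 4) ^ j"
      "\<And>j. ((1 / 4) ^ j - (1 / 4) ^ Suc j) * g (x j) \<le> a j + (1 / 2) ^ j"
    by metis
  have xpos: "x j > 0" for j using x(1)[of j] by (rule less_trans[rotated]) simp
  have level: "sqrt (x j * H (x j)) \<le> 2 * a j + 2 * (1 / 2) ^ j" for j
  proof -
    have g0: "g (x j) \<ge> 0" using H[OF xpos] xpos by (simp add: g_def less_imp_le)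
    have "x j * g (x j) = sqrt ((x j)\<^sup>2) * sqrt (H (x j) / x j)"
      using xpos[of j] by (simp add: g_def)
    also have "\<dots> = sqrt ((x j)\<^sup>2 * (H (x j) / x j))"
      by (simp only: real_sqrt_mult)
    also have "(x j)\<^sup>2 * (H (x j) / x j) = x j * H (x j)"
      using xpos[of j] by (simp add: power2_eq_square)
    finally have "sqrt (x j * H (x j)) = x j * g (x j)" by simp
    also have "\<dots> \<le> (1 / 4) ^ j * g (x j)"
      using g0 x(2) by (intro mult_right_mono)
    also have "\<dots> \<le> 2 * (((1 / 4) ^ j - (1 / 4) ^ Suc j) * g (x j))"
      using g0 by (simp add: algebra_simps)
    also have "\<dots> \<le> 2 * a j + 2 * (1 / 2) ^ j" using mult_left_mono[OF x(3)[of j], of 2] by (simp only: distrib_left)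
    finally show ?thesis .
  qed
  have sum_a: "(\<Sum>j<L. a j) \<le> (LINT x:{0<..}|lebesgue. g x)" for L
  proof -
    have dec: "(1 / 4 :: real) ^ j \<le> (1 / 4) ^ Suc i" if "i < j" for i j :: nat
      using that by (intro power_decreasing) auto
    have "I i \<inter> I j = {}" if "i < j" for i j
      using dec[OF that] unfolding I_def by auto
    hence "disjoint_family_on I {..<L}"
      unfolding disjoint_family_on_def by (metis Int_commute linorder_neqE_nat)
    hence "(\<Sum>j<L. a j) = (LINT x:(\<Union>j<L. I j)|lebesgue. g x)"
      unfolding a_def by (intro set_integral_finite_Union[symmetric] I_int I_sets) simp_all
    also have "\<dots> \<le> (LINT x:{0<..}|lebesgue. g x)"
    proof -
      have sub: "(\<Union>j<L. I j) \<subseteq> {0<..}" using I_sub by blast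
      have "set_integrable lebesgue (\<Union>j<L. I j) g"
        unfolding g_def by (rule set_integrable_subset[OF int _ sub]) (auto simp: I_def)
      thus ?thesis
        using int H sub unfolding set_lebesgue_integral_def set_integrable_def g_def
        by (intro integral_mono) (auto simp: indicator_def)
    qed
    finally show ?thesis .
  qed
  show ?thesis
  proof (rule that[of x])
    fix L
    have "(\<Sum>j<L. sqrt (x j * H (x j))) \<le> (\<Sum>j<L. 2 * a j + 2 * (1 / 2) ^ j)"
      by (intro sum_mono level)
    also have "\<dots> = 2 * (\<Sum>j<L. a j) + 2 * (\<Sum>j<L. (1 / 2) ^ j)"
      by (simp add: sum.distrib sum_distrib_left)
    also have "(\<Sum>j<L. (1 / 2 :: real) ^ j) \<le> 2" by (simp add: sum_gp_strict)
    finally show "(\<Sum>j<L. sqrt (x j * H (x j))) \<le> 2 * (LINT x:{0<..}|lebesgue. sqrt (H x / x)) + 4"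
      using sum_a[of L] by (simp add: g_def)
  qed (rule x)+
qed

text \<open>Cutting off the functions and the centres alike brings them closer together.  The centres become
  vectors of values at the sample points, the only thing that the empirical measure sees.\<close>

lemma empirical_cover_restrict:
  assumes n: "n > 0" and \<xi>: "\<xi> \<in> space (sample_space n P)" and F: "F \<subseteq> borel_measurable P"
    and cover: "L1_cover \<epsilon> F (empirical_measure P n \<xi>) N"
  obtains N' where "finite N'" "card N' \<le> card N"
    and "\<And>g. g \<in> (\<lambda>f x. f x * indicator A x) ` F \<Longrightarrow> \<exists>w\<in>N'. (\<Sum>i<n. \<bar>g (\<xi> i) - w i\<bar>) \<le> n * \<epsilon>"
proof (rule that[of "(\<lambda>g i. g (\<xi> i) * indicator A (\<xi> i)) ` N"])
  have fin: "finite N" using cover by (simp add: L1_cover_def)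
  thus "finite ((\<lambda>g i. g (\<xi> i) * indicator A (\<xi> i)) ` N)"
    and "card ((\<lambda>g i. g (\<xi> i) * indicator A (\<xi> i)) ` N) \<le> card N"
    by (auto intro: card_image_le)
  fix g assume "g \<in> (\<lambda>f x. f x * indicator A x) ` F"
  then obtain f where f: "f \<in> F" "g = (\<lambda>x. f x * indicator A x)" by auto
  then obtain h where h: "h \<in> N" "(\<integral>x. \<bar>f x - h x\<bar> \<partial>empirical_measure P n \<xi>) < \<epsilon>"
    using cover by (auto simp: L1_cover_def)
  have sets_emp: "sets (empirical_measure P n \<xi>) = sets P" by (simp add: empirical_measure_def)
  have "integrable (empirical_measure P n \<xi>) h" using cover h(1) by (simp add: L1_cover_def)
  hence "h \<in> borel_measurable P"
    using measurable_cong_sets[OF sets_emp refl] borel_measurable_integrable by blast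
  hence "(\<lambda>x. \<bar>f x - h x\<bar>) \<in> borel_measurable P"
    using F f(1) by (intro borel_measurable_abs borel_measurable_diff) auto
  hence "(\<Sum>i<n. \<bar>f (\<xi> i) - h (\<xi> i)\<bar>) / n < \<epsilon>"
    using h(2) integral_empirical_measure[OF n \<xi>, of "\<lambda>x. \<bar>f x - h x\<bar>"] by simp
  hence "(\<Sum>i<n. \<bar>f (\<xi> i) - h (\<xi> i)\<bar>) \<le> n * \<epsilon>"
    using n by (simp add: divide_less_eq mult.commute)
  moreover have "(\<Sum>i<n. \<bar>g (\<xi> i) - h (\<xi> i) * indicator A (\<xi> i)\<bar>) \<le> (\<Sum>i<n. \<bar>f (\<xi> i) - h (\<xi> i)\<bar>)"
    by (intro sum_mono) (auto simp: f(2) indicator_def)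
  ultimately show "\<exists>w\<in>(\<lambda>g i. g (\<xi> i) * indicator A (\<xi> i)) ` N. (\<Sum>i<n. \<bar>g (\<xi> i) - w i\<bar>) \<le> n * \<epsilon>"
    using h(1) by (intro bexI[of _ "\<lambda>i. h (\<xi> i) * indicator A (\<xi> i)"]) auto
qed

lemma nn_integral_sample_mean:
  fixes f :: "'a \<Rightarrow> real"
  assumes "prob_space P" "n > 0" "integrable P f" "\<And>x. x \<in> space P \<Longrightarrow> f x \<ge> 0" "c \<ge> 0"
  shows "(\<integral>\<^sup>+\<xi>. ennreal (c + (\<Sum>i<n. f (\<xi> i)) / n) \<partial>sample_space n P) = ennreal (c + (\<integral>x. f x \<partial>P))"
proof -
  define M where "M = sample_space n P"
  interpret M: prob_space M unfolding M_def using assms(1) by (rule prob_space_sample_space)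
  have comp: "integrable M (\<lambda>\<eta>. f (\<eta> i))" "(\<integral>\<eta>. f (\<eta> i) \<partial>M) = (\<integral>x. f x \<partial>P)" if "i < n" for i
    unfolding M_def by (intro integral_sample_space_component assms(1,3) that)+
  have int: "integrable M (\<lambda>\<xi>. c + (\<Sum>i<n. f (\<xi> i)) / n)"
    using comp(1) by (intro Bochner_Integration.integrable_add integrable_divide Bochner_Integration.integrable_sum) auto
  have nonneg: "0 \<le> c + (\<Sum>i<n. f (\<xi> i)) / n" if "\<xi> \<in> space M" for \<xi>
  proof -
    have "\<xi> i \<in> space P" if "i < n" for i
      using \<open>\<xi> \<in> space M\<close> that by (auto simp: M_def sample_space_def space_PiM PiE_iff)
    thus ?thesis using assms(4,5) by (intro add_nonneg_nonneg divide_nonneg_nonneg sum_nonneg) auto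
  qed
  have "(\<integral>\<^sup>+\<xi>. ennreal (c + (\<Sum>i<n. f (\<xi> i)) / n) \<partial>M) = ennreal (\<integral>\<xi>. c + (\<Sum>i<n. f (\<xi> i)) / n \<partial>M)"
    using nonneg by (intro nn_integral_eq_integral int) auto
  also have "(\<integral>\<xi>. c + (\<Sum>i<n. f (\<xi> i)) / n \<partial>M) = c + (\<integral>\<xi>. (\<Sum>i<n. f (\<xi> i)) / n \<partial>M)"
    using comp(1) M.prob_space
    by (subst Bochner_Integration.integral_add)
       (auto intro!: integrable_divide Bochner_Integration.integrable_sum)
  also have "(\<integral>\<xi>. (\<Sum>i<n. f (\<xi> i)) / n \<partial>M) = (\<integral>x. f x \<partial>P)"
    using comp \<open>n > 0\<close> by (simp add: Bochner_Integration.integral_sum)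
  finally show ?thesis by (simp add: M_def)
qed

section \<open>Deviation of classes with an integrable envelope\<close>

text \<open>Given the sample, the entropy bound for Rademacher averages involves the sample mean of the envelope;
  integrating over the sample turns it into the expectation.\<close>

lemma bounded_class_deviation:
  assumes P: "prob_space P" and n: "n > 0" and K: "K > 0" and D: "D \<ge> 1"
    and meas: "P_measurable_class P G" and G: "G \<subseteq> borel_measurable P"
    and env: "\<And>g x. g \<in> G \<Longrightarrow> x \<in> space P \<Longrightarrow> \<bar>g x\<bar> \<le> E x"
    and E: "integrable P E" "\<And>x. x \<in> space P \<Longrightarrow> 0 \<le> E x" "\<And>x. x \<in> space P \<Longrightarrow> E x \<le> K"
    and x: "\<And>j. (1 / 4) ^ Suc j < x j" "\<And>j. x j \<le> (1 / 4) ^ j"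
    and h: "\<And>j. h j \<ge> 0" and S: "\<And>L. (\<Sum>j<L. sqrt (x j * h j)) \<le> S"
    and cover: "AE \<xi> in sample_space n P. \<forall>j. \<exists>N. finite N \<and>
      (\<forall>g\<in>G. \<exists>w\<in>N. (\<Sum>i<n. \<bar>g (\<xi> i) - w i\<bar>) \<le> n * x j) \<and> ln (real (card N)) \<le> D * h j"
  obtains U where "U \<in> borel_measurable (sample_space n P)"
    and "\<And>\<xi>. \<xi> \<in> space (sample_space n P) \<Longrightarrow> sup_deviation (empirical_measure P n \<xi>) P G \<le> U \<xi>"
    and "(\<integral>\<^sup>+\<xi>. U \<xi> \<partial>sample_space n P)
           \<le> ennreal (2 * chaining_constant S * sqrt (K * D / n) * (1 + (\<integral>x. E x \<partial>P)))"
proof -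
  let ?M = "sample_space n P"
  interpret P: prob_space P by fact
  define s where "s = chaining_constant S * sqrt (K * D / n)"
  have S0: "S \<ge> 0" using S[of 0] by simp
  have s: "s \<ge> 0" using S0 K D by (simp add: s_def chaining_constant_def)
  have int: "integrable P g" if "g \<in> G" for g
  proof (rule P.integrable_const_bound[where B = K])
    show "AE x in P. norm (g x) \<le> K"
      using env[OF that] E(3) by (intro AE_I2) (force intro: order.trans)
  qed (use G that in auto)
  obtain U where U: "U \<in> borel_measurable ?M"
    "\<And>\<xi>. \<xi> \<in> space ?M \<Longrightarrow> sup_deviation (empirical_measure P n \<xi>) P G \<le> U \<xi>"
    "(\<integral>\<^sup>+\<xi>. U \<xi> \<partial>?M) = ennreal (2 / (real n * 2 ^ n)) *
      (\<integral>\<^sup>+\<xi>. (\<Sum>e\<in>signs n. SUP g\<in>G. ennreal \<bar>\<Sum>i<n. e i * g (\<xi> i)\<bar>) \<partial>?M)"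
    by (rule symmetrization[OF P n meas int]) (assumption, rule that)
  have "(\<integral>\<^sup>+\<xi>. (\<Sum>e\<in>signs n. SUP g\<in>G. ennreal \<bar>\<Sum>i<n. e i * g (\<xi> i)\<bar>) \<partial>?M)
      \<le> (\<integral>\<^sup>+\<xi>. ennreal (2 ^ n * (n * (s * (1 + (\<Sum>i<n. E (\<xi> i)) / n)))) \<partial>?M)"
  proof (rule nn_integral_mono_AE)
    show "AE \<xi> in ?M. (\<Sum>e\<in>signs n. SUP g\<in>G. ennreal \<bar>\<Sum>i<n. e i * g (\<xi> i)\<bar>)
        \<le> ennreal (2 ^ n * (n * (s * (1 + (\<Sum>i<n. E (\<xi> i)) / n))))"
      using cover AE_space
    proof eventually_elim
      case (elim \<xi>)
      have sp: "\<xi> i \<in> space P" if "i < n" for i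
        using elim(2) that by (auto simp: sample_space_def space_PiM PiE_iff)
      show ?case
        unfolding s_def
        by (rule rademacher_entropy_bound[where v = "\<lambda>g i. g (\<xi> i)" and F = G and x = x and h = h])
           (use n K D env E sp x h S elim(1) in auto)
    qed
  qed
  also have "\<dots> = (\<integral>\<^sup>+\<xi>. ennreal (2 ^ n * (n * s)) * ennreal (1 + (\<Sum>i<n. E (\<xi> i)) / n) \<partial>?M)"
    using s by (intro nn_integral_cong) (simp add: ennreal_mult'[symmetric] mult.assoc)
  also have "\<dots> = ennreal (2 ^ n * (n * s)) * (\<integral>\<^sup>+\<xi>. ennreal (1 + (\<Sum>i<n. E (\<xi> i)) / n) \<partial>?M)"
  proof (rule nn_integral_cmult)
    have "E \<in> borel_measurable P" using E(1) by auto
    have "(\<lambda>\<xi>. E (\<xi> i)) \<in> borel_measurable ?M" if "i < n" for i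
      using that by (intro measurable_compose[OF measurable_sample_space_component \<open>E \<in> borel_measurable P\<close>])
    hence "(\<lambda>\<xi>. \<Sum>i<n. E (\<xi> i)) \<in> borel_measurable ?M"
      by (intro borel_measurable_sum) (simp only: lessThan_iff)
    thus "(\<lambda>\<xi>. ennreal (1 + (\<Sum>i<n. E (\<xi> i)) / n)) \<in> borel_measurable ?M" by simp
  qed
  also have "(\<integral>\<^sup>+\<xi>. ennreal (1 + (\<Sum>i<n. E (\<xi> i)) / n) \<partial>?M) = ennreal (1 + (\<integral>x. E x \<partial>P))"
    by (rule nn_integral_sample_mean) (use P n E in auto)
  finally have "(\<integral>\<^sup>+\<xi>. U \<xi> \<partial>?M) \<le> ennreal (2 / (real n * 2 ^ n)) *
      (ennreal (2 ^ n * (n * s)) * ennreal (1 + (\<integral>x. E x \<partial>P)))"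
    unfolding U(3) by (intro mult_left_mono) auto
  also have "\<dots> = ennreal (2 / (real n * 2 ^ n) * (2 ^ n * (n * s)) * (1 + (\<integral>x. E x \<partial>P)))"
  proof -
    have "0 \<le> 2 / (real n * 2 ^ n)" "0 \<le> 2 ^ n * (n * s)" using s by simp_all
    thus ?thesis by (simp only: ennreal_mult'[symmetric] mult.assoc)
  qed
  also have "2 / (real n * 2 ^ n) * (2 ^ n * (n * s)) = 2 * chaining_constant S * sqrt (K * D / n)"
    using n by (simp add: s_def)
  finally show ?thesis
    using that U(1,2) by blast
qed

text \<open>The part of a function outside \<open>A\<close> is controlled by the envelope alone, so it contributes to both means
  the same majorant for all functions of the class.\<close>

lemma sup_deviation_truncate:
  assumes "prob_space P" and n: "n > 0" and F: "F \<subseteq> borel_measurable P" and A: "A \<in> sets P"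
    and env: "\<And>f x. f \<in> F \<Longrightarrow> x \<in> space P \<Longrightarrow> \<bar>f x\<bar> \<le> E x"
    and E: "integrable P E" and \<xi>: "\<xi> \<in> space (sample_space n P)"
  shows "sup_deviation (empirical_measure P n \<xi>) P F
    \<le> sup_deviation (empirical_measure P n \<xi>) P ((\<lambda>f x. f x * indicator A x) ` F)
      + ennreal ((\<integral>x. E x * indicator (- A) x \<partial>P) + (\<Sum>i<n. E (\<xi> i) * indicator (- A) (\<xi> i)) / n)"
    (is "_ \<le> ?G + ennreal ?T")
  unfolding sup_deviation_def[of _ _ F]
proof (rule SUP_least)
  fix f assume f: "f \<in> F"
  define g where "g x = f x * indicator A x" for x
  define Q where "Q = empirical_measure P n \<xi>"
  have [measurable]: "f \<in> borel_measurable P" "A \<in> sets P" "E \<in> borel_measurable P"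
    using F f A E by auto
  have g [measurable]: "g \<in> borel_measurable P" unfolding g_def by measurable
  have sp: "\<xi> i \<in> space P" if "i < n" for i
    using \<xi> that by (auto simp: sample_space_def space_PiM PiE_iff)
  have pw: "\<bar>f x - g x\<bar> \<le> E x * indicator (- A) x" if "x \<in> space P" for x
    using env[OF f that] by (auto simp: g_def indicator_def)
  have intE: "integrable P (\<lambda>x. E x * indicator (- A) x)"
  proof (rule Bochner_Integration.integrable_bound[OF E])
    have "(\<lambda>x. E x * indicator (space P - A) x) \<in> borel_measurable P" by measurable
    thus "(\<lambda>x. E x * indicator (- A) x) \<in> borel_measurable P"
      by (rule measurable_cong[THEN iffD1, rotated]) (auto simp: indicator_def)
  qed (auto simp: indicator_def)
  have intf: "integrable P f"
    by (rule Bochner_Integration.integrable_bound[OF E]) (auto intro!: AE_I2 order.trans[OF env[OF f] abs_ge_self])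
  have intg: "integrable P g"
    by (rule Bochner_Integration.integrable_bound[OF intf]) (auto simp: g_def indicator_def)
  have "\<bar>(\<integral>x. f x \<partial>P) - (\<integral>x. g x \<partial>P)\<bar> = \<bar>\<integral>x. f x - g x \<partial>P\<bar>"
    using intf intg by simp
  also have "\<dots> \<le> (\<integral>x. \<bar>f x - g x\<bar> \<partial>P)" by (rule integral_abs_bound)
  also have "\<dots> \<le> (\<integral>x. E x * indicator (- A) x \<partial>P)"
    using intf intg intE pw by (intro integral_mono) auto
  finally have 1: "\<bar>(\<integral>x. f x \<partial>P) - (\<integral>x. g x \<partial>P)\<bar> \<le> (\<integral>x. E x * indicator (- A) x \<partial>P)" .
  have "(\<integral>x. f x \<partial>Q) - (\<integral>x. g x \<partial>Q) = (\<Sum>i<n. f (\<xi> i)) / n - (\<Sum>i<n. g (\<xi> i)) / n"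
    unfolding Q_def using integral_empirical_measure[OF n \<xi>, of f] integral_empirical_measure[OF n \<xi> g]
    by simp
  also have "\<dots> = (\<Sum>i<n. f (\<xi> i) - g (\<xi> i)) / n"
    by (simp only: sum_subtractf diff_divide_distrib)
  finally have "\<bar>(\<integral>x. f x \<partial>Q) - (\<integral>x. g x \<partial>Q)\<bar> = \<bar>\<Sum>i<n. f (\<xi> i) - g (\<xi> i)\<bar> / n"
    by simp
  also have "\<dots> \<le> (\<Sum>i<n. E (\<xi> i) * indicator (- A) (\<xi> i)) / n"
    using pw sp by (intro divide_right_mono order.trans[OF sum_abs] sum_mono) auto
  finally have 2: "\<bar>(\<integral>x. f x \<partial>Q) - (\<integral>x. g x \<partial>Q)\<bar> \<le> (\<Sum>i<n. E (\<xi> i) * indicator (- A) (\<xi> i)) / n" .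
  have T: "?T \<ge> 0" using 1 2 by linarith
  have "ennreal \<bar>(\<integral>x. f x \<partial>Q) - (\<integral>x. f x \<partial>P)\<bar> \<le> ennreal (\<bar>(\<integral>x. g x \<partial>Q) - (\<integral>x. g x \<partial>P)\<bar> + ?T)"
    using 1 2 by (intro ennreal_leI) linarith
  also have "\<dots> = ennreal \<bar>(\<integral>x. g x \<partial>Q) - (\<integral>x. g x \<partial>P)\<bar> + ennreal ?T"
    using T by (intro ennreal_plus) auto
  also have "ennreal \<bar>(\<integral>x. g x \<partial>Q) - (\<integral>x. g x \<partial>P)\<bar> \<le> ?G"
    unfolding sup_deviation_def Q_def by (rule SUP_upper) (use f in \<open>auto simp: g_def\<close>)
  finally show "ennreal \<bar>(\<integral>x. f x \<partial>Q) - (\<integral>x. f x \<partial>P)\<bar> \<le> ?G + ennreal ?T" 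
    by (simp add: add_right_mono)
qed

section \<open>Choice of the truncation level\<close>

lemma norm2_nonneg: "norm2 d x \<ge> 0"
  by (simp add: norm2_def)

lemma borel_measurable_bracket: "bracket d \<in> borel_measurable (Rd d)"
proof -
  have "(\<lambda>x. x i) \<in> borel_measurable (Rd d)" if "i < d" for i
    unfolding Rd_def using that by (intro measurable_component_singleton) simp
  hence "(\<lambda>x. \<Sum>i<d. (x i)\<^sup>2) \<in> borel_measurable (Rd d)"
    by (intro borel_measurable_sum borel_measurable_power) (simp only: lessThan_iff)
  hence "(\<lambda>x. 1 + sqrt (\<Sum>i<d. (x i)\<^sup>2)) \<in> borel_measurable (Rd d)"
    by simp
  thus ?thesis unfolding bracket_def[abs_def] norm2_def L2_set_def .
qed

lemma bracket_powr_le: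
  assumes "p \<ge> 0"
  shows "bracket d x powr p \<le> 2 powr p * (1 + norm2 d x powr p)"
proof -
  define t where "t = norm2 d x"
  have t: "t \<ge> 0" by (simp add: t_def norm2_nonneg)
  have "(1 + t) powr p \<le> (2 * max 1 t) powr p"
    using t assms by (intro powr_mono2) auto
  also have "\<dots> = 2 powr p * max 1 t powr p" by (simp add: powr_mult)
  also have "\<dots> \<le> 2 powr p * (1 + t powr p)"
    by (intro mult_left_mono) (auto simp: max_def)
  finally show ?thesis by (simp add: bracket_def t_def)
qed

lemma rate_bound:
  fixes D N \<theta> :: real
  assumes "D > 0" "N \<ge> 1" "0 \<le> \<theta>" "\<theta> \<le> 1"
  shows "(N / D) powr (- (\<theta> / 2)) \<le> D powr (\<theta> / 2) * N powr (- (\<theta>\<^sup>2 / 2))"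
proof -
  have "\<theta>\<^sup>2 \<le> \<theta>" using assms by (simp add: power2_eq_square mult_left_le)
  have "(N / D) powr (- (\<theta> / 2)) = D powr (\<theta> / 2) * N powr (- (\<theta> / 2))"
    using assms by (simp add: powr_divide powr_minus divide_simps)
  also have "\<dots> \<le> D powr (\<theta> / 2) * N powr (- (\<theta>\<^sup>2 / 2))"
    using assms \<open>\<theta>\<^sup>2 \<le> \<theta>\<close> by (intro mult_left_mono powr_mono) auto
  finally show ?thesis .
qed

theorem lemma3p19:
  fixes B b c M J :: real
  assumes "B > 0" and "b \<ge> 0" and "c > 0"
  shows "\<exists>C>0. \<forall>(d :: nat) (n :: nat) (P :: (nat \<Rightarrow> real) measure)
      (\<F> :: ((nat \<Rightarrow> real) \<Rightarrow> real) set) (D :: real) (H :: real \<Rightarrow> real).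
    d \<ge> 1 \<longrightarrow> n \<ge> 1 \<longrightarrow>
    prob_space P \<longrightarrow> sets P = sets (Rd d) \<longrightarrow>
    \<F> \<subseteq> borel_measurable (Rd d) \<longrightarrow> P_measurable_class P \<F> \<longrightarrow>
    is_envelope (Rd d) \<F> (\<lambda>x. B * bracket d x powr (b + 2)) \<longrightarrow>
    integrable P (\<lambda>x. norm2 d x powr (b + 2 + c)) \<longrightarrow>
    (\<integral>x. norm2 d x powr (b + 2 + c) \<partial>P) = M \<longrightarrow>
    D > 1 \<longrightarrow> (\<forall>x>0. H x \<ge> 0) \<longrightarrow>
    (\<forall>x>0. AE \<xi> in sample_space n P.
       L1_log_covering_number x \<F> (empirical_measure (Rd d) n \<xi>) \<le> ereal (D * H x)) \<longrightarrow>
    set_integrable lebesgue {0<..} (\<lambda>x. sqrt (H x / x)) \<longrightarrow>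
    (LINT x:{0<..}|lebesgue. sqrt (H x / x)) = J \<longrightarrow>
    outer_expectation (sample_space n P)
        (\<lambda>\<xi>. sup_deviation (empirical_measure (Rd d) n \<xi>) P \<F>)
      \<le> ennreal (C * D powr (c / (2 * (b + 2 + c)))
                    * real n powr (- (c\<^sup>2 / (2 * (b + 2 + c)\<^sup>2))))"
proof -
  define q where "q = b + 2"
  define p where "p = b + 2 + c"
  define \<theta> where "\<theta> = c / p"
  \<comment> \<open>The absolute values keep the constant positive when no measure or entropy function has the data \<open>M\<close>, \<open>J\<close>.\<close>
  define m where "m = 2 powr p * (1 + \<bar>M\<bar>)"
  define S where "S = 2 * \<bar>J\<bar> + 4"
  define C where "C = 2 * chaining_constant S * sqrt B * (1 + B * m) + 2 * (B * m)"
  have q: "q > 0" and p: "p > 0" "p = q + c" using assms by (simp_all add: p_def q_def)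
  have \<theta>: "0 \<le> \<theta>" "\<theta> \<le> 1" using p q assms by (simp_all add: \<theta>_def)
  have m: "m > 0" by (simp add: m_def add_pos_nonneg)
  have EC: "chaining_constant S > 0" by (simp add: S_def chaining_constant_def add_nonneg_pos)
  have C: "C > 0" using assms m EC by (auto simp: C_def intro!: add_pos_pos mult_pos_pos)
  show ?thesis
  proof (intro exI[of _ C] conjI C allI impI)
    fix d n :: nat and P :: "(nat \<Rightarrow> real) measure" and F :: "((nat \<Rightarrow> real) \<Rightarrow> real) set"
      and D :: real and H :: "real \<Rightarrow> real"
    assume n: "n \<ge> 1" and P: "prob_space P" and sets_P: "sets P = sets (Rd d)"
      and F: "F \<subseteq> borel_measurable (Rd d)" and meas: "P_measurable_class P F"
      and env: "is_envelope (Rd d) F (\<lambda>x. B * bracket d x powr (b + 2))"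
      and moment: "integrable P (\<lambda>x. norm2 d x powr (b + 2 + c))"
        "(\<integral>x. norm2 d x powr (b + 2 + c) \<partial>P) = M"
      and D: "D > 1" and H: "\<forall>x>0. H x \<ge> 0"
      and entropy: "\<forall>x>0. AE \<xi> in sample_space n P.
        L1_log_covering_number x F (empirical_measure (Rd d) n \<xi>) \<le> ereal (D * H x)"
      and Dudley: "set_integrable lebesgue {0<..} (\<lambda>x. sqrt (H x / x))"
        "(LINT x:{0<..}|lebesgue. sqrt (H x / x)) = J"
    interpret P: prob_space P by fact
    let ?M = "sample_space n P"
    let ?br = "bracket d"
    have space_P: "space P = space (Rd d)" using sets_P by (rule sets_eq_imp_space_eq)
    have n0: "n > 0" using n by simp
    have emp: "empirical_measure (Rd d) n \<xi> = empirical_measure P n \<xi>" for \<xi>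
      unfolding empirical_measure_def by (intro distr_cong refl) (simp add: sets_P)
    have FP: "F \<subseteq> borel_measurable P"
      using F measurable_cong_sets[OF sets_P refl] by blast
    have br [measurable]: "?br \<in> borel_measurable P"
      using borel_measurable_bracket measurable_cong_sets[OF sets_P refl] by blast
    have br1: "?br x \<ge> 1" for x by (simp add: bracket_def norm2_nonneg)

    have int_br: "integrable P (\<lambda>x. ?br x powr p)"
    proof (rule Bochner_Integration.integrable_bound)
      show "integrable P (\<lambda>x. 2 powr p * (1 + norm2 d x powr p))"
        using moment(1) by (simp add: p_def)
      show "AE x in P. norm (?br x powr p) \<le> norm (2 powr p * (1 + norm2 d x powr p))"
        using p bracket_powr_le[of p d] by (intro AE_I2) simp
    qed measurable
    have "(\<integral>x. ?br x powr p \<partial>P) \<le> (\<integral>x. 2 powr p * (1 + norm2 d x powr p) \<partial>P)"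
      using int_br moment(1) bracket_powr_le[of p d] p by (intro integral_mono) (auto simp: p_def)
    also have "\<dots> \<le> m"
      using moment by (simp add: p_def m_def P.prob_space)
    finally have br_m: "(\<integral>x. ?br x powr p \<partial>P) \<le> m" .

    \<comment> \<open>The ratio \<open>w\<close> may be below \<open>1\<close>; then \<open>A\<close> is empty and the tail bound below is the trivial one.\<close>
    define w where "w = real n / D"
    define R where "R = w powr (1 / p)"
    define K where "K = B * R powr q"
    define \<rho> where "\<rho> = w powr (- (\<theta> / 2))"
    define E where "E x = B * ?br x powr q" for x
    define A where "A = {x \<in> space P. ?br x \<le> R}"
    have w: "w > 0" using n0 D by (simp add: w_def)
    have R: "R > 0" using w by (simp add: R_def)
    have K: "K > 0" using R assms by (simp add: K_def)
    have A: "A \<in> sets P" unfolding A_def by measurable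
    have E_nonneg: "E x \<ge> 0" for x using assms by (simp add: E_def)
    have E_meas: "E \<in> borel_measurable P" unfolding E_def by measurable
    have E_le: "E x \<le> B * ?br x powr p" for x
      unfolding E_def using assms p br1[of x] by (intro mult_left_mono powr_mono) auto
    have int_E: "integrable P E"
      by (rule Bochner_Integration.integrable_bound[of _ "\<lambda>x. B * ?br x powr p"])
         (use int_br E_meas E_le E_nonneg assms in auto)
    have env': "\<bar>f x\<bar> \<le> E x" if "f \<in> F" "x \<in> space P" for f x
      using env that by (simp add: is_envelope_def space_P E_def q_def)

    define E1 where "E1 x = E x * indicator A x" for x
    define E2 where "E2 x = E x * indicator (- A) x" for x
    have E1: "integrable P E1"
      unfolding E1_def using integrable_mult_indicator[OF A int_E] by (simp add: mult.commute)
    have E2_eq: "E2 x = E x - E1 x" for x by (simp add: E1_def E2_def indicator_def)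
    have E2: "integrable P E2" unfolding E2_eq[abs_def] using int_E E1 by simp
    have E2_nonneg: "E2 x \<ge> 0" for x by (simp add: E2_def E_nonneg)
    have E1_le: "E1 x \<le> K" for x
    proof (cases "x \<in> A")
      case True
      hence "?br x powr q \<le> R powr q" using br1[of x] q by (intro powr_mono2) (auto simp: A_def)
      thus ?thesis using True assms by (simp add: E1_def E_def K_def)
    next
      case False
      thus ?thesis using K by (simp add: E1_def)
    qed
    have int_E1: "(\<integral>x. E1 x \<partial>P) \<le> B * m"
    proof -
      have "(\<integral>x. E1 x \<partial>P) \<le> (\<integral>x. B * ?br x powr p \<partial>P)"
      proof (intro integral_mono)
        show "E1 x \<le> B * ?br x powr p" for x
          using E_le[of x] E_nonneg[of x] by (auto simp: E1_def indicator_def)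
      qed (use E1 int_br in auto)
      also have "\<dots> \<le> B * m" using br_m assms by simp
      finally show ?thesis .
    qed
    have tail: "(\<integral>x. E2 x \<partial>P) \<le> B * m * \<rho>"
    proof -
      have "(\<integral>x. E2 x \<partial>P) \<le> (\<integral>x. B * \<rho> * ?br x powr p \<partial>P)"
      proof (intro integral_mono)
        fix x assume x: "x \<in> space P"
        show "E2 x \<le> B * \<rho> * ?br x powr p"
        proof (cases "x \<in> A")
          case True
          thus ?thesis using assms by (simp add: E2_def \<rho>_def)
        next
          case False
          hence "R \<le> ?br x" using x by (auto simp: A_def)
          \<comment> \<open>Half of the decay suffices for the rate, and it also holds for \<open>R < 1\<close> since \<open>\<langle>x\<rangle> \<ge> 1\<close>.\<close>
          have "?br x powr (- c) \<le> ?br x powr (- (c / 2))"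
            using assms br1[of x] by (intro powr_mono) auto
          also have "\<dots> \<le> R powr (- (c / 2))"
            using assms R \<open>R \<le> ?br x\<close> by (intro powr_mono2') auto
          also have "\<dots> = \<rho>" by (simp add: R_def \<rho>_def \<theta>_def powr_powr)
          finally have "?br x powr (- c) * ?br x powr p \<le> \<rho> * ?br x powr p"
            by (intro mult_right_mono) auto
          hence "?br x powr q \<le> \<rho> * ?br x powr p"
            using p(2) by (simp flip: powr_add)
          thus ?thesis using False assms by (simp add: E2_def E_def mult.assoc)
        qed
      qed (use E2 int_br in auto)
      also have "\<dots> = B * \<rho> * (\<integral>x. ?br x powr p \<partial>P)" by simp
      also have "\<dots> \<le> B * \<rho> * m" using br_m assms by (intro mult_left_mono) (auto simp: \<rho>_def)
      finally show ?thesis by (simp add: mult_ac)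
    qed

    obtain x where x: "\<And>j. (1 / 4) ^ Suc j < x j" "\<And>j. x j \<le> (1 / 4) ^ j"
      and xS: "\<And>L. (\<Sum>j<L. sqrt (x j * H (x j))) \<le> 2 * (LINT x:{0<..}|lebesgue. sqrt (H x / x)) + 4"
      by (rule entropy_scales[of H]) (use H Dudley(1) in \<open>auto\<close>)
    have xpos: "x j > 0" for j using x(1)[of j] by (rule less_trans[rotated]) simp
    have xS': "(\<Sum>j<L. sqrt (x j * H (x j))) \<le> S" for L
      using xS[of L] Dudley(2) by (simp add: S_def)

    define G where "G = (\<lambda>f x. f x * indicator A x) ` F"
    have G_meas: "G \<subseteq> borel_measurable P" using FP A by (auto simp: G_def)
    have G_env: "\<bar>g x\<bar> \<le> E1 x" if "g \<in> G" "x \<in> space P" for g x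
      using that env' by (auto simp: G_def E1_def indicator_def)
    have "AE \<xi> in ?M. \<forall>j. L1_log_covering_number (x j) F (empirical_measure P n \<xi>) \<le> ereal (D * H (x j))"
      using entropy xpos by (subst AE_all_countable) (auto simp: emp)
    hence cover: "AE \<xi> in ?M. \<forall>j. \<exists>N. finite N \<and>
      (\<forall>g\<in>G. \<exists>w\<in>N. (\<Sum>i<n. \<bar>g (\<xi> i) - w i\<bar>) \<le> n * x j) \<and> ln (real (card N)) \<le> D * H (x j)"
      using AE_space
    proof eventually_elim
      case (elim \<xi>)
      show ?case
      proof
        fix j
        obtain N where N: "L1_cover (x j) F (empirical_measure P n \<xi>) N" "ln (real (card N)) \<le> D * H (x j)"
          using elim(1) L1_cover_of_log_covering_number by blast
        obtain N' where N': "finite N'" "card N' \<le> card N"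
          "\<And>g. g \<in> G \<Longrightarrow> \<exists>w\<in>N'. (\<Sum>i<n. \<bar>g (\<xi> i) - w i\<bar>) \<le> n * x j"
          using empirical_cover_restrict[OF n0 elim(2) FP N(1), of A] unfolding G_def by blast
        show "\<exists>N. finite N \<and> (\<forall>g\<in>G. \<exists>w\<in>N. (\<Sum>i<n. \<bar>g (\<xi> i) - w i\<bar>) \<le> n * x j)
            \<and> ln (real (card N)) \<le> D * H (x j)"
          using N' N(2) order.trans[OF ln_of_nat_mono[OF N'(2)] N(2)] by blast
      qed
    qed
    obtain U where U: "U \<in> borel_measurable ?M"
      "\<And>\<xi>. \<xi> \<in> space ?M \<Longrightarrow> sup_deviation (empirical_measure P n \<xi>) P G \<le> U \<xi>"
      "(\<integral>\<^sup>+\<xi>. U \<xi> \<partial>?M) \<le> ennreal (2 * chaining_constant S * sqrt (K * D / n) * (1 + (\<integral>x. E1 x \<partial>P)))"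
    proof (rule bounded_class_deviation[of P n K D G E1 x "\<lambda>j. H (x j)" S])
      show "P_measurable_class P G" unfolding G_def by (rule P_measurable_class_restrict[OF meas A])
      show "0 \<le> E1 x" for x by (simp add: E1_def E_nonneg)
    qed (use P n0 K D G_meas G_env E1 E1_le x xS' cover H xpos in \<open>auto\<close>)

    define T where "T \<xi> = ennreal ((\<integral>x. E2 x \<partial>P) + (\<Sum>i<n. E2 (\<xi> i)) / n)" for \<xi> :: "nat \<Rightarrow> nat \<Rightarrow> real"
    have E2_int_nonneg: "0 \<le> (\<integral>x. E2 x \<partial>P)" by (intro integral_nonneg_AE AE_I2 E2_nonneg)
    have T_meas: "T \<in> borel_measurable ?M"
    proof -
      have "E2 \<in> borel_measurable P" using E2 by auto
      hence "(\<lambda>\<xi>. E2 (\<xi> i)) \<in> borel_measurable ?M" if "i < n" for i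
        using measurable_compose[OF measurable_sample_space_component[OF that]] by blast
      hence "(\<lambda>\<xi>. \<Sum>i<n. E2 (\<xi> i)) \<in> borel_measurable ?M"
        by (intro borel_measurable_sum) (simp only: lessThan_iff)
      thus ?thesis unfolding T_def by simp
    qed
    have "outer_expectation ?M (\<lambda>\<xi>. sup_deviation (empirical_measure (Rd d) n \<xi>) P F) \<le> (\<integral>\<^sup>+\<xi>. U \<xi> + T \<xi> \<partial>?M)"
    proof (rule outer_expectation_le)
      fix \<xi> assume \<xi>: "\<xi> \<in> space ?M"
      have "sup_deviation (empirical_measure P n \<xi>) P F \<le> sup_deviation (empirical_measure P n \<xi>) P G + T \<xi>"
        unfolding G_def T_def E2_def
        by (rule sup_deviation_truncate[OF P n0 FP A _ int_E \<xi>]) (rule env')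
      also have "\<dots> \<le> U \<xi> + T \<xi>" by (intro add_right_mono U(2) \<xi>)
      finally show "sup_deviation (empirical_measure (Rd d) n \<xi>) P F \<le> U \<xi> + T \<xi>" by (simp add: emp)
    qed (use U(1) T_meas in simp)
    also have "\<dots> = (\<integral>\<^sup>+\<xi>. U \<xi> \<partial>?M) + (\<integral>\<^sup>+\<xi>. T \<xi> \<partial>?M)"
      using U(1) T_meas by (rule nn_integral_add)
    also have "(\<integral>\<^sup>+\<xi>. T \<xi> \<partial>?M) = ennreal (2 * (\<integral>x. E2 x \<partial>P))"
      unfolding T_def using nn_integral_sample_mean[OF P n0 E2 E2_nonneg E2_int_nonneg] by simp
    also have "(\<integral>\<^sup>+\<xi>. U \<xi> \<partial>?M) + ennreal (2 * (\<integral>x. E2 x \<partial>P))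
        \<le> ennreal (2 * chaining_constant S * (sqrt B * \<rho>) * (1 + B * m)) + ennreal (2 * (B * m * \<rho>))"
    proof (intro add_mono order.trans[OF U(3)] ennreal_leI)
      have "K * D / n = B * (w powr (q / p) * w powr (- 1))"
        using w n0 D by (simp add: K_def R_def powr_powr w_def powr_minus_divide field_simps)
      also have "w powr (q / p) * w powr (- 1) = w powr (- \<theta>)"
      proof -
        have "q / p + - 1 = - \<theta>" using p by (simp add: \<theta>_def field_simps)
        thus ?thesis by (simp only: powr_add[symmetric])
      qed
      also have "\<dots> = \<rho> * \<rho>" by (simp add: \<rho>_def flip: powr_add)
      finally have "sqrt (K * D / n) = sqrt B * \<rho>"
        using w by (simp add: real_sqrt_mult \<rho>_def)
      thus "2 * chaining_constant S * sqrt (K * D / n) * (1 + (\<integral>x. E1 x \<partial>P))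
          \<le> 2 * chaining_constant S * (sqrt B * \<rho>) * (1 + B * m)"
        using EC assms int_E1 by (auto simp: \<rho>_def intro!: mult_left_mono)
      show "2 * (\<integral>x. E2 x \<partial>P) \<le> 2 * (B * m * \<rho>)" using tail by simp
    qed
    also have "\<dots> = ennreal (2 * chaining_constant S * (sqrt B * \<rho>) * (1 + B * m) + 2 * (B * m * \<rho>))"
      using EC assms m by (intro ennreal_plus[symmetric]) (auto simp: \<rho>_def)
    also have "2 * chaining_constant S * (sqrt B * \<rho>) * (1 + B * m) + 2 * (B * m * \<rho>) = C * \<rho>"
      by (simp add: C_def algebra_simps)
    also have "\<rho> \<le> D powr (\<theta> / 2) * real n powr (- (\<theta>\<^sup>2 / 2))"
      unfolding \<rho>_def w_def using D n \<theta> by (intro rate_bound) auto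
    hence "ennreal (C * \<rho>) \<le> ennreal (C * (D powr (\<theta> / 2) * real n powr (- (\<theta>\<^sup>2 / 2))))"
      using C by (intro ennreal_leI mult_left_mono) auto
    also have "C * (D powr (\<theta> / 2) * real n powr (- (\<theta>\<^sup>2 / 2)))
        = C * D powr (c / (2 * (b + 2 + c))) * real n powr (- (c\<^sup>2 / (2 * (b + 2 + c)\<^sup>2)))"
      by (simp add: \<theta>_def p_def power_divide mult.commute mult.left_commute)
    finally show "outer_expectation ?M (\<lambda>\<xi>. sup_deviation (empirical_measure (Rd d) n \<xi>) P F)
      \<le> ennreal (C * D powr (c / (2 * (b + 2 + c))) * real n powr (- (c\<^sup>2 / (2 * (b + 2 + c)\<^sup>2))))" .
  qed
qed

end
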